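(* Let $\mathbb{M}^1$ and $\mathbb{M}^2$ be weight sequences, let $S$ be an unbounded sector bisected by direction $0$, and suppose that $G_{\mathbb{M}^1}$ is an optimal $\{\mathbb{M}^1\}$-flat function in $S$ and $G_{\mathbb{M}^2}$ is an optimal $\{\mathbb{M}^2\}$-flat function in $S$. Then the product $G_{\mathbb{M}^1}\cdot G_{\mathbb{M}^2}$ is an optimal $\{\mathbb{M}^1\star\mathbb{M}^2\}$-flat function in $S$. Moreover, if at least one of $\mathbb{M}^1$, $\mathbb{M}^2$ satisfies (dc), then $\mathbb{L}:=\mathbb{M}^1\star\mathbb{M}^2$ satisfies (dc), and there exists $c>0$ such that for every $A>0$ there exists a linear continuous map $T_{\mathbb{L},A}\colon\mathbb{C}[[z]]_{\mathbb{L},A}\to\widetilde{\mathcal{A}}^u_{\mathbb{L},cA}(S)$ such that $\widetilde{\mathcal{B}}\circ T_{\mathbb{L},A}$ is the identity map in $\mathbb{C}[[z]]_{\mathbb{L},A}$.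
   Context: A weight sequence is a sequence $\mathbb{M}=(M_p)_{p\in\mathbb{N}_0}$ of positive real numbers with $M_0=1$, logarithmically convex ($M_p^2\le M_{p-1}M_{p+1}$, $p\ge1$), and such that $M_{p+1}/M_p\to\infty$. (dc): there is $D>0$ with $M_{p+1}\le D^{p+1}M_p$ for all $p\in\mathbb{N}_0$. Convolved sequence: $\mathbb{M}^1\star\mathbb{M}^2=(L_p)_{p\in\mathbb{N}_0}$ with $L_p:=\min_{0\le q\le p}M^1_qM^2_{p-q}$; it is again a weight sequence when $\mathbb{M}^1,\mathbb{M}^2$ are (a known fact of Komatsu). Sectors lie in the Riemann surface $\mathcal{R}$ of the logarithm; an unbounded sector bisected by direction $0$ is $\{z\in\mathcal{R}:|\arg z|<\gamma\pi/2\}$ for some $\gamma>0$. With $h_{\mathbb{M}}(t):=\inf_{p\in\mathbb{N}_0}M_pt^p$ for $t>0$, a holomorphic $G\colon S\to\mathbb{C}$ is an optimal $\{\mathbb{M}\}$-flat function in $S$ if there are $K_1,K_2,K_3,K_4>0$ with $K_1h_{\mathbb{M}}(K_2x)\le G(x)$ for all $x>0$ (in particular $G(x)>0$) and $|G(z)|\le K_3h_{\mathbb{M}}(K_4|z|)$ for all $z\in S$. For $A>0$: $\widetilde{\mathcal{A}}^u_{\mathbb{M},A}(S)$ is the Banach space of holomorphic $f\colon S\to\mathbb{C}$ for which there is a formal series $\widehat f=\sum_{n\ge0}a_nz^n$ with finite norm $\sup_{z\in S,\,p\in\mathbb{N}_0}\frac{|f(z)-\sum_{k=0}^{p-1}a_kz^k|}{A^pM_p|z|^p}$.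 $\mathbb{C}[[z]]_{\mathbb{M},A}$ is the Banach space of formal series $\sum a_pz^p$ with finite norm $\sup_p\frac{|a_p|}{A^pM_p}$. The asymptotic Borel map $\widetilde{\mathcal{B}}$ sends $f$ to $\widehat f$. *)

theory Defs
  imports "HOL-Complex_Analysis.Complex_Analysis" "HOL-Computational_Algebra.Formal_Power_Series"
begin

section \<open>Weight sequences\<close>

definition weight_sequence :: "(nat \<Rightarrow> real) \<Rightarrow> bool" where
  "weight_sequence M \<longleftrightarrow>
     (\<forall>p. 0 < M p) \<and> M 0 = 1 \<and>
     (\<forall>p\<ge>1. (M p)\<^sup>2 \<le> M (p - 1) * M (p + 1)) \<and>
     filterlim (\<lambda>p. M (p + 1) / M p) at_top sequentially"

definition dc :: "(nat \<Rightarrow> real) \<Rightarrow> bool" where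
  "dc M \<longleftrightarrow> (\<exists>D>0. \<forall>p. M (p + 1) \<le> D ^ (p + 1) * M p)"

definition conv_seq :: "(nat \<Rightarrow> real) \<Rightarrow> (nat \<Rightarrow> real) \<Rightarrow> nat \<Rightarrow> real"  (infixl "\<star>" 70) where
  "(M1 \<star> M2) p = Min ((\<lambda>q. M1 q * M2 (p - q)) ` {0..p})"

definition h_fun :: "(nat \<Rightarrow> real) \<Rightarrow> real \<Rightarrow> real" where
  "h_fun M t = (INF p. M p * t ^ p)"

section \<open>The Riemann surface of the logarithm\<close>

text \<open>
  A point of the surface is given by its modulus r > 0 and its (unrestricted) argument, as a pair
  (r, \<theta>); pairs with r \<le> 0 are not points of the surface. The positive real x is (x, 0).
\<close>

type_synonym log_point = "real \<times> real"

definition log_surface :: "log_point set" where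
  "log_surface = {z. 0 < fst z}"

abbreviation rs_abs :: "log_point \<Rightarrow> real" where "rs_abs z \<equiv> fst z"
abbreviation rs_arg :: "log_point \<Rightarrow> real" where "rs_arg z \<equiv> snd z"

definition rs_proj :: "log_point \<Rightarrow> complex" where
  "rs_proj z = rcis (rs_abs z) (rs_arg z)"

text \<open>The inverse of the global chart log = ln r + i \<theta> of the surface.\<close>

definition rs_exp :: "complex \<Rightarrow> log_point" where
  "rs_exp w = (exp (Re w), Im w)"

definition rs_holomorphic_on :: "(log_point \<Rightarrow> complex) \<Rightarrow> log_point set \<Rightarrow> bool"
    (infixl "rs'_holomorphic'_on" 50) where
  "f rs_holomorphic_on S \<longleftrightarrow> (\<lambda>w. f (rs_exp w)) holomorphic_on (rs_exp -` S)"

definition sector :: "real \<Rightarrow> log_point set" where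
  "sector \<gamma> = {z \<in> log_surface. \<bar>rs_arg z\<bar> < \<gamma> * pi / 2}"

lemma rs_proj_exp: "rs_proj (rs_exp w) = exp w"
  by (simp add: rs_proj_def rs_exp_def rcis_def exp_eq_polar)

lemma norm_rs_proj: "z \<in> log_surface \<Longrightarrow> norm (rs_proj z) = rs_abs z"
  by (simp add: rs_proj_def log_surface_def)

text \<open>
  Over the slit plane, holomorphy on the surface is ordinary holomorphy after projection.
\<close>

lemma rs_holomorphic_on_iff:
  assumes S: "S \<subseteq> sector 2"
  shows "(\<lambda>z. F (rs_proj z)) rs_holomorphic_on S \<longleftrightarrow> F holomorphic_on (rs_proj ` S)"
proof
  assume "F holomorphic_on (rs_proj ` S)"
  moreover have "exp ` (rs_exp -` S) \<subseteq> rs_proj ` S"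
    by (force simp: rs_proj_exp[symmetric])
  ultimately have "(F \<circ> exp) holomorphic_on (rs_exp -` S)"
    by (intro holomorphic_on_compose holomorphic_on_exp) (auto elim: holomorphic_on_subset)
  then show "(\<lambda>z. F (rs_proj z)) rs_holomorphic_on S"
    by (simp add: rs_holomorphic_on_def rs_proj_exp o_def)
next
  assume "(\<lambda>z. F (rs_proj z)) rs_holomorphic_on S"
  then have *: "(\<lambda>w. F (exp w)) holomorphic_on (rs_exp -` S)"
    by (simp add: rs_holomorphic_on_def rs_proj_exp)
  have eq: "rs_proj z \<notin> \<real>\<^sub>\<le>\<^sub>0 \<and> rs_exp (Ln (rs_proj z)) = z" if "z \<in> S" for z
  proof -
    from that S have z: "0 < rs_abs z" "\<bar>rs_arg z\<bar> < pi"
      by (auto simp: sector_def log_surface_def)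
    define w where "w = Complex (ln (rs_abs z)) (rs_arg z)"
    have w: "rs_exp w = z" using z by (simp add: rs_exp_def w_def)
    have "Ln (exp w) = w" using z by (intro Ln_exp) (auto simp: w_def)
    moreover have "exp w \<notin> \<real>\<^sub>\<le>\<^sub>0"
    proof
      assume "exp w \<in> \<real>\<^sub>\<le>\<^sub>0"
      then have "Im (Ln (exp w)) = pi"
        by (metis Arg_eq_Im_Ln Arg_eq_pi exp_not_eq_zero complex_nonpos_Reals_iff
            complex_eq_iff order_le_less zero_complex.sel)
      then show False using z \<open>Ln (exp w) = w\<close> by (simp add: w_def)
    qed
    ultimately show ?thesis using w rs_proj_exp[of w] by simp
  qed
  have "((\<lambda>w. F (exp w)) \<circ> Ln) holomorphic_on (rs_proj ` S)"
    using * eq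
    by (intro holomorphic_on_compose holomorphic_on_Ln) (auto elim!: holomorphic_on_subset)
  then show "F holomorphic_on (rs_proj ` S)"
  proof (rule holomorphic_transform)
    fix y assume "y \<in> rs_proj ` S"
    then have "y \<noteq> 0" using eq by fastforce
    then show "((\<lambda>w. F (exp w)) \<circ> Ln) y = F y" by (simp add: exp_Ln)
  qed
qed

section \<open>Optimal flat functions\<close>

definition optimal_flat ::
    "(nat \<Rightarrow> real) \<Rightarrow> log_point set \<Rightarrow> (log_point \<Rightarrow> complex) \<Rightarrow> bool" where
  "optimal_flat M S G \<longleftrightarrow>
     G rs_holomorphic_on S \<and>
     (\<exists>K1>0. \<exists>K2>0. \<exists>K3>0. \<exists>K4>0.
        (\<forall>x>0. G (x, 0) \<in> \<real> \<and> K1 * h_fun M (K2 * x) \<le> Re (G (x, 0))) \<and>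
        (\<forall>z\<in>S. norm (G z) \<le> K3 * h_fun M (K4 * rs_abs z)))"

section \<open>Formal power series and functions with uniform asymptotic expansion\<close>

definition fps_quotients :: "(nat \<Rightarrow> real) \<Rightarrow> real \<Rightarrow> complex fps \<Rightarrow> real set" where
  "fps_quotients M A a = range (\<lambda>p. norm (fps_nth a p) / (A ^ p * M p))"

definition fps_space :: "(nat \<Rightarrow> real) \<Rightarrow> real \<Rightarrow> complex fps set" where
  "fps_space M A = {a. bdd_above (fps_quotients M A a)}"

definition fps_space_norm :: "(nat \<Rightarrow> real) \<Rightarrow> real \<Rightarrow> complex fps \<Rightarrow> real" where
  "fps_space_norm M A a = Sup (fps_quotients M A a)"

definition asymp_quotients ::
    "(nat \<Rightarrow> real) \<Rightarrow> real \<Rightarrow> log_point set \<Rightarrow> (log_point \<Rightarrow> complex) \<Rightarrow> complex fps \<Rightarrow> real set" where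
  "asymp_quotients M A S f a =
     (\<lambda>(z, p). norm (f z - (\<Sum>k<p. fps_nth a k * rs_proj z ^ k)) / (A ^ p * M p * rs_abs z ^ p))
       ` (S \<times> UNIV)"

definition asymp_space ::
    "(nat \<Rightarrow> real) \<Rightarrow> real \<Rightarrow> log_point set \<Rightarrow> (log_point \<Rightarrow> complex) set" where
  "asymp_space M A S =
     {f. f rs_holomorphic_on S \<and> (\<exists>a. bdd_above (asymp_quotients M A S f a))}"

text \<open>The expansion is unique, by \<open>asymp_expansion_unique\<close> below.\<close>

definition borel_map ::
    "(nat \<Rightarrow> real) \<Rightarrow> real \<Rightarrow> log_point set \<Rightarrow> (log_point \<Rightarrow> complex) \<Rightarrow> complex fps" where
  "borel_map M A S f = (THE a. bdd_above (asymp_quotients M A S f a))"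

definition asymp_space_norm ::
    "(nat \<Rightarrow> real) \<Rightarrow> real \<Rightarrow> log_point set \<Rightarrow> (log_point \<Rightarrow> complex) \<Rightarrow> real" where
  "asymp_space_norm M A S f = Sup (asymp_quotients M A S f (borel_map M A S f))"

lemma asymp_expansion_unique:
  assumes M: "\<And>p. 0 < M p" and A: "0 < A" and g: "0 < \<gamma>"
    and a: "bdd_above (asymp_quotients M A (sector \<gamma>) f a)"
    and b: "bdd_above (asymp_quotients M A (sector \<gamma>) f b)"
  shows "a = b"
proof (rule ccontr)
  assume "a \<noteq> b"
  then have ex: "\<exists>p. fps_nth a p \<noteq> fps_nth b p" by (simp add: fps_eq_iff)
  define p where "p = (LEAST p. fps_nth a p \<noteq> fps_nth b p)"
  have p: "fps_nth a p \<noteq> fps_nth b p" unfolding p_def using ex by (rule LeastI_ex)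
  have less: "fps_nth a k = fps_nth b k" if "k < p" for k
    using not_less_Least[of k "\<lambda>p. fps_nth a p \<noteq> fps_nth b p"] that by (auto simp: p_def)
  have bound: "\<exists>C. \<forall>x>0. norm (f (x, 0) - (\<Sum>k<Suc p. fps_nth s k * of_real x ^ k)) \<le> C * x ^ Suc p"
    if s: "bdd_above (asymp_quotients M A (sector \<gamma>) f s)" for s
  proof -
    from s obtain B where B: "\<And>y. y \<in> asymp_quotients M A (sector \<gamma>) f s \<Longrightarrow> y \<le> B"
      by (auto simp: bdd_above_def)
    have "norm (f (x, 0) - (\<Sum>k<Suc p. fps_nth s k * of_real x ^ k)) \<le> (B * (A ^ Suc p * M (Suc p))) * x ^ Suc p"
      if x: "0 < x" for x
    proof -
      have mem: "((x, 0), Suc p) \<in> sector \<gamma> \<times> UNIV"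
        using x g by (simp add: sector_def log_surface_def)
      have "norm (f (x, 0) - (\<Sum>k<Suc p. fps_nth s k * rs_proj (x, 0) ^ k))
            / (A ^ Suc p * M (Suc p) * rs_abs (x, 0) ^ Suc p) \<in> asymp_quotients M A (sector \<gamma>) f s"
        unfolding asymp_quotients_def by (rule image_eqI[OF _ mem]) simp
      from B[OF this] have "norm (f (x, 0) - (\<Sum>k<Suc p. fps_nth s k * of_real x ^ k))
            / (A ^ Suc p * M (Suc p) * x ^ Suc p) \<le> B"
        by (simp add: rs_proj_def rcis_def)
      moreover have "0 < A ^ Suc p * M (Suc p) * x ^ Suc p"
        using A M x by (intro mult_pos_pos zero_less_power) auto
      ultimately show ?thesis by (simp only: pos_divide_le_eq mult.assoc)
    qed
    then show ?thesis by blast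
  qed
  obtain C where C: "\<And>x. 0 < x \<Longrightarrow> norm (f (x, 0) - (\<Sum>k<Suc p. fps_nth a k * of_real x ^ k)) \<le> C * x ^ Suc p"
    using bound[OF a] by blast
  obtain D where D: "\<And>x. 0 < x \<Longrightarrow> norm (f (x, 0) - (\<Sum>k<Suc p. fps_nth b k * of_real x ^ k)) \<le> D * x ^ Suc p"
    using bound[OF b] by blast
  define d where "d = norm (fps_nth a p - fps_nth b p)"
  have d: "0 < d" using p by (simp add: d_def)
  have le: "d \<le> (C + D) * x" if x: "0 < x" for x :: real
  proof -
    have "(\<Sum>k<p. fps_nth a k * of_real x ^ k) = (\<Sum>k<p. fps_nth b k * of_real x ^ k)"
      using less by (intro sum.cong) auto
    then have "(fps_nth a p - fps_nth b p) * of_real x ^ p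
        = (f (x, 0) - (\<Sum>k<Suc p. fps_nth b k * of_real x ^ k))
          - (f (x, 0) - (\<Sum>k<Suc p. fps_nth a k * of_real x ^ k))"
      by (simp add: algebra_simps)
    then have "d * x ^ p = norm ((f (x, 0) - (\<Sum>k<Suc p. fps_nth b k * of_real x ^ k))
          - (f (x, 0) - (\<Sum>k<Suc p. fps_nth a k * of_real x ^ k)))"
      using x by (metis d_def norm_mult norm_power norm_of_real abs_of_pos)
    also have "\<dots> \<le> D * x ^ Suc p + C * x ^ Suc p"
      by (rule order_trans[OF norm_triangle_ineq4 add_mono[OF D[OF x] C[OF x]]])
    also have "\<dots> = ((C + D) * x) * x ^ p" by (simp add: algebra_simps)
    finally show ?thesis using x by (simp add: mult_le_cancel_right)
  qed
  define E where "E = C + D"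
  have "0 < E" using le[of 1] d by (simp add: E_def)
  then have "E * (d / (2 * E)) = d / 2" and "0 < d / (2 * E)" using d by simp_all
  then show False using le[of "d / (2 * E)"] d unfolding E_def[symmetric] by linarith
qed

section \<open>Linear continuous maps between the two spaces\<close>

text \<open>
  Elements of \<open>asymp_space\<close> are functions on S, so equality of images is equality on S.
\<close>

definition linear_map_on ::
    "complex fps set \<Rightarrow> log_point set \<Rightarrow> (complex fps \<Rightarrow> log_point \<Rightarrow> complex) \<Rightarrow> bool" where
  "linear_map_on V S T \<longleftrightarrow>
     (\<forall>a\<in>V. \<forall>b\<in>V. \<forall>z\<in>S. T (a + b) z = T a z + T b z) \<and>
     (\<forall>c. \<forall>a\<in>V. \<forall>z\<in>S. T (fps_const c * a) z = c * T a z)"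

definition linear_continuous_map ::
    "(nat \<Rightarrow> real) \<Rightarrow> real \<Rightarrow> real \<Rightarrow> log_point set
      \<Rightarrow> (complex fps \<Rightarrow> log_point \<Rightarrow> complex) \<Rightarrow> bool" where
  "linear_continuous_map M A B S T \<longleftrightarrow>
     T ` fps_space M A \<subseteq> asymp_space M B S \<and>
     linear_map_on (fps_space M A) S T \<and>
     (\<forall>a\<in>fps_space M A. \<forall>\<epsilon>>0. \<exists>\<delta>>0. \<forall>b\<in>fps_space M A.
        fps_space_norm M A (b - a) < \<delta> \<longrightarrow>
        asymp_space_norm M B S (\<lambda>z. T b z - T a z) < \<epsilon>)"

end

theory Submission imports Defs
begin

text \<open>
  The identity \<open>h_fun (M1 \<star> M2) = h_fun M1 * h_fun M2\<close> makes the product of the two flat functions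
  optimal for \<open>L = M1 \<star> M2\<close>. For any optimal flat \<open>G\<close> the moments
  \<open>m p = \<integral> G (1 / u) u ^ p du\<close> over the positive half-line are comparable with \<open>L p\<close> up to geometric factors:
  from above by (dc), from below because \<open>L p = h_fun L t / t ^ p\<close> for some bounded \<open>t > 0\<close>. Hence
  \<open>\<Sum> a p / m p * u ^ p\<close> has a positive radius of convergence, and the Laplace-type transform
  \<open>(1 / z) * \<integral> G (z / u) * (\<Sum> a p / m p * u ^ p) du\<close> over an interval \<open>(0, R)\<close> is the required
  extension, since \<open>\<integral> G (z / u) u ^ p du = m p * z ^ (p + 1)\<close> over the whole half-line.
\<close>

section \<open>Convolved sequences\<close>

text \<open>The transform sends a polynomial exactly to its counterpart, so the remainder of order
  \<open>N\<close> of the extension is itself the transform of the truncated series minus its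
  partial sum. The interval ends at half the guaranteed radius of convergence
  \<open>1 / \<rho>\<close>, because this difference is then at most a multiple of
  \<open>(2 * \<rho>) ^ N * u ^ N\<close> for every \<open>u > 0\<close>; no tail of a moment
  integral has to be estimated separately. Convergence at infinity costs two further powers of
  \<open>u\<close>, hence the index \<open>N + 2\<close> in the bound of the kernel, and (dc) is
  applied twice to return from \<open>N + 2\<close> to \<open>N\<close>. The moments are bounded
  below with rate \<open>K2 / 2\<close> and the kernel above with rate
  \<open>K4 * D\<^sup>2\<close>; together with the factor 2 from the cut this gives
  \<open>c = 4 * K4 * D\<^sup>2 / K2\<close>, independent of \<open>A\<close>. The cut itself
  depends on \<open>A\<close>, but not on the series, which keeps the extension linear. Analysis on
  the surface is done in the logarithmic chart, where a sector is a horizontal strip and dividing by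
  \<open>u\<close> is a real translation.\<close>

lemma h_fun_bdd_below:
  fixes M :: "nat \<Rightarrow> real"
  assumes "\<And>p. 0 < M p" and "0 \<le> t"
  shows "bdd_below (range (\<lambda>p. M p * t ^ p))"
proof (rule bdd_belowI[of _ 0])
  have "0 \<le> M p * t ^ p" for p
    using assms(1)[of p] assms(2) by simp
  then show "0 \<le> x" if "x \<in> range (\<lambda>p. M p * t ^ p)" for x
    using that by auto
qed

lemma h_fun_le:
  assumes "\<And>p. 0 < M p" and "0 \<le> t"
  shows "h_fun M t \<le> M p * t ^ p"
  unfolding h_fun_def by (rule cINF_lower[OF h_fun_bdd_below[of M t, OF assms] UNIV_I])

lemma h_fun_nonneg:
  assumes "\<And>p. 0 < M p" and "0 \<le> t"
  shows "0 \<le> h_fun M t"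
proof -
  have "0 \<le> M p * t ^ p" for p
    using assms(1)[of p] assms(2) by simp
  then show ?thesis unfolding h_fun_def by (intro cINF_greatest) auto
qed

lemma h_fun_mono:
  assumes "\<And>p. 0 < M p" and "0 \<le> s" and "s \<le> t"
  shows "h_fun M s \<le> h_fun M t"
proof -
  have "h_fun M s \<le> M p * t ^ p" for p
    using h_fun_le[of M s p, OF assms(1,2)] mult_left_mono[OF power_mono[OF assms(3,2), of p]
        less_imp_le[OF assms(1)[of p]]] by linarith
  then show ?thesis unfolding h_fun_def[of M t] by (intro cINF_greatest) auto
qed

lemma conv_seq_le:
  assumes "q \<le> p"
  shows "(M1 \<star> M2) p \<le> M1 q * M2 (p - q)"
  unfolding conv_seq_def using assms by (intro Min_le) auto

lemma conv_seq_attained: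
  obtains q where "q \<le> p" and "(M1 \<star> M2) p = M1 q * M2 (p - q)"
proof -
  have "(M1 \<star> M2) p \<in> (\<lambda>q. M1 q * M2 (p - q)) ` {0..p}"
    unfolding conv_seq_def by (intro Min_in) auto
  then show thesis using that by auto
qed

lemma conv_seq_pos:
  assumes "\<And>p. 0 < M1 p" and "\<And>p. 0 < M2 p"
  shows "0 < (M1 \<star> M2) p"
proof -
  obtain q where "(M1 \<star> M2) p = M1 q * M2 (p - q)"
    by (rule conv_seq_attained)
  then show ?thesis using assms(1)[of q] assms(2)[of "p - q"] by simp
qed

lemma conv_seq_commute: "M1 \<star> M2 = M2 \<star> M1"
proof (rule ext, rule antisym)
  have "(M1 \<star> M2) p \<le> (M2 \<star> M1) p" for M1 M2 p
  proof -
    obtain q where "q \<le> p" and "(M2 \<star> M1) p = M2 q * M1 (p - q)"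
      by (rule conv_seq_attained)
    then show ?thesis using conv_seq_le[of "p - q" p M1 M2] by (simp add: mult.commute)
  qed
  then show "(M1 \<star> M2) p \<le> (M2 \<star> M1) p" "(M2 \<star> M1) p \<le> (M1 \<star> M2) p" for p
    by blast+
qed

text \<open>The minimum over splittings turns the infimum over \<open>p\<close> into an infimum over
  two independent indices \<open>q\<close> and \<open>r\<close> of a product of nonnegative terms,
  which factors.\<close>

lemma h_fun_conv_seq:
  assumes M1: "\<And>p. 0 < M1 p" and M2: "\<And>p. 0 < M2 p" and t: "0 \<le> t"
  shows "h_fun (M1 \<star> M2) t = h_fun M1 t * h_fun M2 t"
proof (rule antisym)
  note L = conv_seq_pos[of M1 M2, OF M1 M2]
  have split: "h_fun (M1 \<star> M2) t \<le> (M1 q * t ^ q) * (M2 r * t ^ r)" for q r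
  proof -
    have "h_fun (M1 \<star> M2) t \<le> (M1 \<star> M2) (q + r) * t ^ (q + r)"
      by (rule h_fun_le[of "M1 \<star> M2", OF L t])
    also have "\<dots> \<le> (M1 q * M2 r) * t ^ (q + r)"
      using conv_seq_le[of q "q + r" M1 M2] t by (intro mult_right_mono) auto
    finally show ?thesis by (simp add: power_add mult_ac)
  qed
  \<comment> \<open>The infimum is taken in one index at a time, after division by the other factor;
    a factor that vanishes, as can happen at \<open>t = 0\<close>, is treated apart.\<close>
  have "h_fun (M1 \<star> M2) t \<le> h_fun M1 t * (M2 r * t ^ r)" for r
  proof (cases "M2 r * t ^ r = 0")
    case True
    with split[of 0 r] show ?thesis by (simp only: mult_zero_right)
  next
    case False
    moreover have "0 \<le> M2 r * t ^ r" using M2[of r] t by simp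
    ultimately have pos: "0 < M2 r * t ^ r" by linarith
    have "h_fun (M1 \<star> M2) t / (M2 r * t ^ r) \<le> M1 q * t ^ q" for q
      using split[of q r] pos by (simp only: pos_divide_le_eq)
    then have "h_fun (M1 \<star> M2) t / (M2 r * t ^ r) \<le> h_fun M1 t"
      unfolding h_fun_def[of M1] by (intro cINF_greatest) auto
    then show ?thesis using pos by (simp only: pos_divide_le_eq)
  qed note half = this
  show "h_fun (M1 \<star> M2) t \<le> h_fun M1 t * h_fun M2 t"
  proof (cases "h_fun M1 t = 0")
    case True
    then show ?thesis using half[of 0] by simp
  next
    case False
    with h_fun_nonneg[of M1, OF M1 t] have pos: "0 < h_fun M1 t" by linarith
    have "h_fun (M1 \<star> M2) t / h_fun M1 t \<le> M2 r * t ^ r" for r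
      using half[of r] pos by (simp add: pos_divide_le_eq mult.commute)
    then have "h_fun (M1 \<star> M2) t / h_fun M1 t \<le> h_fun M2 t"
      unfolding h_fun_def[of M2] by (intro cINF_greatest) auto
    then show ?thesis using pos by (simp add: pos_divide_le_eq mult.commute)
  qed
  show "h_fun M1 t * h_fun M2 t \<le> h_fun (M1 \<star> M2) t"
    unfolding h_fun_def[of "M1 \<star> M2"]
  proof (intro cINF_greatest)
    fix p
    obtain q where q: "q \<le> p" and eq: "(M1 \<star> M2) p = M1 q * M2 (p - q)"
      by (rule conv_seq_attained)
    have "h_fun M1 t * h_fun M2 t \<le> (M1 q * t ^ q) * (M2 (p - q) * t ^ (p - q))"
      using h_fun_le[of M1, OF M1 t, of q] h_fun_le[of M2, OF M2 t, of "p - q"]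
        h_fun_nonneg[of M2, OF M2 t] M1[of q] t
      by (intro mult_mono) simp_all
    also have "\<dots> = (M1 \<star> M2) p * (t ^ q * t ^ (p - q))" by (simp add: eq mult_ac)
    also have "t ^ q * t ^ (p - q) = t ^ p" using q by (simp flip: power_add)
    finally show "h_fun M1 t * h_fun M2 t \<le> (M1 \<star> M2) p * t ^ p" .
  qed auto
qed

section \<open>Products of optimal flat functions\<close>

lemma optimal_flatE:
  assumes "optimal_flat M S G"
  obtains K1 K2 K3 K4 where "0 < K1" "0 < K2" "0 < K3" "0 < K4"
    and "G rs_holomorphic_on S"
    and "\<And>x. 0 < x \<Longrightarrow> G (x, 0) \<in> \<real>"
    and "\<And>x. 0 < x \<Longrightarrow> K1 * h_fun M (K2 * x) \<le> Re (G (x, 0))"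
    and "\<And>z. z \<in> S \<Longrightarrow> norm (G z) \<le> K3 * h_fun M (K4 * rs_abs z)"
  using assms unfolding optimal_flat_def
proof (elim conjE exE, goal_cases)
  case (1 K1 K2 K3 K4)
  show thesis by (rule that[of K1 K2 K3 K4]) (use 1 in simp_all)
qed

lemma optimal_flatI:
  assumes "0 < K1" and "0 < K2" and "0 < K3" and "0 < K4"
    and "G rs_holomorphic_on S"
    and "\<And>x. 0 < x \<Longrightarrow> G (x, 0) \<in> \<real>"
    and "\<And>x. 0 < x \<Longrightarrow> K1 * h_fun M (K2 * x) \<le> Re (G (x, 0))"
    and "\<And>z. z \<in> S \<Longrightarrow> norm (G z) \<le> K3 * h_fun M (K4 * rs_abs z)"
  shows "optimal_flat M S G"
  unfolding optimal_flat_def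
proof (intro conjI)
  show "\<exists>K1>0. \<exists>K2>0. \<exists>K3>0. \<exists>K4>0.
      (\<forall>x>0. G (x, 0) \<in> \<real> \<and> K1 * h_fun M (K2 * x) \<le> Re (G (x, 0))) \<and>
      (\<forall>z\<in>S. norm (G z) \<le> K3 * h_fun M (K4 * rs_abs z))"
    by (rule exI[of _ K1], rule conjI[OF assms(1)], rule exI[of _ K2], rule conjI[OF assms(2)],
        rule exI[of _ K3], rule conjI[OF assms(3)], rule exI[of _ K4], rule conjI[OF assms(4)])
      (use assms(6-8) in simp)
qed (fact assms(5))

lemma optimal_flat_mult:
  assumes M1: "\<And>p. 0 < M1 p" and M2: "\<And>p. 0 < M2 p"
    and S: "S \<subseteq> log_surface"
    and G1: "optimal_flat M1 S G1" and G2: "optimal_flat M2 S G2"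
  shows "optimal_flat (M1 \<star> M2) S (\<lambda>z. G1 z * G2 z)"
proof -
  obtain K1 K2 K3 K4 where K: "0 < K1" "0 < K2" "0 < K3" "0 < K4"
    and hol1: "G1 rs_holomorphic_on S" and real1: "\<And>x. 0 < x \<Longrightarrow> G1 (x, 0) \<in> \<real>"
    and lo: "\<And>x. 0 < x \<Longrightarrow> K1 * h_fun M1 (K2 * x) \<le> Re (G1 (x, 0))"
    and up: "\<And>z. z \<in> S \<Longrightarrow> norm (G1 z) \<le> K3 * h_fun M1 (K4 * rs_abs z)"
    using optimal_flatE[OF G1] by metis
  obtain K1' K2' K3' K4' where K': "0 < K1'" "0 < K2'" "0 < K3'" "0 < K4'"
    and hol2: "G2 rs_holomorphic_on S" and real2: "\<And>x. 0 < x \<Longrightarrow> G2 (x, 0) \<in> \<real>"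
    and lo': "\<And>x. 0 < x \<Longrightarrow> K1' * h_fun M2 (K2' * x) \<le> Re (G2 (x, 0))"
    and up': "\<And>z. z \<in> S \<Longrightarrow> norm (G2 z) \<le> K3' * h_fun M2 (K4' * rs_abs z)"
    using optimal_flatE[OF G2] by metis
  note pos1 = h_fun_nonneg[of M1, OF M1] and pos2 = h_fun_nonneg[of M2, OF M2]
  have hol: "(\<lambda>z. G1 z * G2 z) rs_holomorphic_on S"
    using hol1 hol2 unfolding rs_holomorphic_on_def by (rule holomorphic_on_mult)
  have lower: "(K1 * K1') * h_fun (M1 \<star> M2) (min K2 K2' * x) \<le> Re (G1 (x, 0) * G2 (x, 0))"
    and real: "G1 (x, 0) * G2 (x, 0) \<in> \<real>" if x: "0 < x" for x
  proof -
    \<comment> \<open>\<open>h_fun\<close> is increasing, so the smaller scale bounds both factors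
      from below at one common point, where the product formula applies. The upper bound uses the
      larger scale in the same way.\<close>
    let ?t = "min K2 K2' * x"
    have t: "0 \<le> ?t" "?t \<le> K2 * x" "?t \<le> K2' * x" using x K K' by auto
    have "(K1 * K1') * h_fun (M1 \<star> M2) ?t = (K1 * h_fun M1 ?t) * (K1' * h_fun M2 ?t)"
      unfolding h_fun_conv_seq[of M1 M2, OF M1 M2 t(1)] by (simp only: mult_ac)
    also have "\<dots> \<le> (K1 * h_fun M1 (K2 * x)) * (K1' * h_fun M2 (K2' * x))"
    proof (rule mult_mono)
      show "K1 * h_fun M1 ?t \<le> K1 * h_fun M1 (K2 * x)"
        using K h_fun_mono[of M1, OF M1 t(1,2)] by simp
      show "K1' * h_fun M2 ?t \<le> K1' * h_fun M2 (K2' * x)"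
        using K' h_fun_mono[of M2, OF M2 t(1,3)] by simp
    qed (use K K' x t pos1 pos2 in simp_all)
    also have "\<dots> \<le> Re (G1 (x, 0)) * Re (G2 (x, 0))"
    proof (rule mult_mono)
      have "0 \<le> K1 * h_fun M1 (K2 * x)" using K x pos1 by simp
      then show "0 \<le> Re (G1 (x, 0))" using lo[OF x] by linarith
    qed (use K' x lo[OF x] lo'[OF x] pos2 in simp_all)
    also have "\<dots> = Re (G1 (x, 0) * G2 (x, 0))"
      using real1[OF x] real2[OF x] by (simp add: complex_is_Real_iff)
    finally show "(K1 * K1') * h_fun (M1 \<star> M2) ?t \<le> Re (G1 (x, 0) * G2 (x, 0))" .
    show "G1 (x, 0) * G2 (x, 0) \<in> \<real>" using real1[OF x] real2[OF x] by (rule Reals_mult)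
  qed
  have upper: "norm (G1 z * G2 z) \<le> (K3 * K3') * h_fun (M1 \<star> M2) (max K4 K4' * rs_abs z)"
    if z: "z \<in> S" for z
  proof -
    let ?t = "max K4 K4' * rs_abs z"
    have r: "0 < rs_abs z" using z S by (auto simp: log_surface_def)
    have t: "0 \<le> K4 * rs_abs z" "K4 * rs_abs z \<le> ?t" "0 \<le> K4' * rs_abs z" "K4' * rs_abs z \<le> ?t" "0 \<le> ?t"
      using r K K' by auto
    have "norm (G1 z * G2 z) \<le> (K3 * h_fun M1 (K4 * rs_abs z)) * (K3' * h_fun M2 (K4' * rs_abs z))"
      unfolding norm_mult using K pos1[OF t(1)] up[OF z] up'[OF z] by (intro mult_mono) simp_all
    also have "\<dots> \<le> (K3 * h_fun M1 ?t) * (K3' * h_fun M2 ?t)"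
    proof (rule mult_mono)
      show "K3 * h_fun M1 (K4 * rs_abs z) \<le> K3 * h_fun M1 ?t"
        using K h_fun_mono[of M1, OF M1 t(1,2)] by simp
      show "K3' * h_fun M2 (K4' * rs_abs z) \<le> K3' * h_fun M2 ?t"
        using K' h_fun_mono[of M2, OF M2 t(3,4)] by simp
    qed (use K K' t pos1 pos2 in simp_all)
    also have "\<dots> = (K3 * K3') * h_fun (M1 \<star> M2) ?t"
      unfolding h_fun_conv_seq[of M1 M2, OF M1 M2 t(5)] by (simp only: mult_ac)
    finally show ?thesis .
  qed
  show ?thesis
  proof (rule optimal_flatI)
    show "0 < K1 * K1'" "0 < min K2 K2'" "0 < K3 * K3'" "0 < max K4 K4'"
      using K K' by simp_all
  qed (fact hol real lower upper)+
qed

section \<open>Condition (dc) and attained infima for convolved sequences\<close>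

lemma dc_conv_seq_left:
  assumes M1: "\<And>p. 0 < M1 p" and M2: "\<And>p. 0 < M2 p" and dc: "dc M1"
  shows "dc (M1 \<star> M2)"
proof -
  obtain D where D: "0 < D" "\<And>p. M1 (p + 1) \<le> D ^ (p + 1) * M1 p"
    using dc unfolding dc_def by blast
  \<comment> \<open>In a minimal splitting of \<open>p\<close> the extra index goes to the factor
    with (dc). This yields the exponent \<open>q + 1\<close>, and a base of at least 1 lets it grow
    to \<open>p + 1\<close>.\<close>
  have "(M1 \<star> M2) (p + 1) \<le> (max 1 D) ^ (p + 1) * (M1 \<star> M2) p" for p
  proof -
    obtain q where q: "q \<le> p" and eq: "(M1 \<star> M2) p = M1 q * M2 (p - q)"
      by (rule conv_seq_attained)
    have "(M1 \<star> M2) (p + 1) \<le> M1 (q + 1) * M2 (p - q)"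
      using conv_seq_le[of "q + 1" "p + 1" M1 M2] q by simp
    also have "\<dots> \<le> (max 1 D ^ (p + 1) * M1 q) * M2 (p - q)"
    proof (intro mult_right_mono order_trans[OF D(2)])
      have "D ^ (q + 1) \<le> max 1 D ^ (q + 1)" using D by (intro power_mono) auto
      also have "\<dots> \<le> max 1 D ^ (p + 1)" using q by (intro power_increasing) auto
      finally show "D ^ (q + 1) \<le> max 1 D ^ (p + 1)" .
    qed (rule less_imp_le[OF M1] less_imp_le[OF M2])+
    finally show ?thesis by (simp add: eq mult_ac)
  qed
  then show ?thesis unfolding dc_def by (intro exI[of _ "max 1 D"]) auto
qed

lemma dc_conv_seq:
  assumes "\<And>p. 0 < M1 p" and "\<And>p. 0 < M2 p" and "dc M1 \<or> dc M2"
  shows "dc (M1 \<star> M2)"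
  using assms dc_conv_seq_left[of M1 M2] dc_conv_seq_left[of M2 M1] conv_seq_commute[of M1 M2] by auto

text \<open>By log-convexity the quotients \<open>M (p + 1) / M p\<close> increase, so the terms
  \<open>M p / s ^ p\<close> decrease as long as the quotient is at most \<open>s\<close> and
  increase afterwards. The hypotheses place \<open>s\<close> between the quotients just before and
  just after \<open>q\<close>; at \<open>q = 0\<close> there is none before, hence the guard in
  \<open>lo\<close>.\<close>

lemma h_fun_eq_at_quotient:
  assumes M: "weight_sequence M" and s: "0 < s"
    and lo: "0 < q \<Longrightarrow> M q \<le> s * M (q - 1)" and hi: "s * M q \<le> M (q + 1)"
  shows "h_fun M (1 / s) = M q * (1 / s) ^ q"
proof -
  have pos: "0 < M p" for p using M by (simp add: weight_sequence_def)
  have lc: "M p / M (p - 1) \<le> M (p + 1) / M p" if "1 \<le> p" for p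
    using M pos[of p] pos[of "p - 1"] that
    by (simp add: weight_sequence_def divide_simps power2_eq_square mult.commute)
  have "incseq (\<lambda>p. M (Suc p) / M p)"
    using lc[of "Suc _"] by (intro incseq_SucI) simp
  then have mono: "M (Suc i) / M i \<le> M (Suc j) / M j" if "i \<le> j" for i j
    using that by (auto dest: incseqD)
  have up: "s * M p \<le> M (Suc p)" if "q \<le> p" for p
  proof -
    have "s \<le> M (Suc q) / M q" using hi pos[of q] by (simp add: pos_le_divide_eq)
    then have "s \<le> M (Suc p) / M p" using mono[OF that] by linarith
    then show ?thesis using pos[of p] by (simp add: pos_le_divide_eq)
  qed
  have down: "M (Suc p) \<le> s * M p" if "p < q" for p
  proof -
    have "M (Suc p) / M p \<le> M (Suc (q - 1)) / M (q - 1)" using that by (intro mono) auto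
    also have "\<dots> \<le> s" using lo pos[of "q - 1"] that by (simp add: pos_divide_le_eq)
    finally show ?thesis using pos[of p] by (simp add: pos_divide_le_eq)
  qed
  define F where "F p = M p * (1 / s) ^ p" for p
  have F_up: "F p \<le> F (Suc p)" if "q \<le> p" for p
    using up[OF that] s by (simp add: F_def divide_simps mult_ac)
  have F_down: "F (Suc p) \<le> F p" if "p < q" for p
    using down[OF that] s by (simp add: F_def divide_simps mult_ac)
  have "F q \<le> F p" for p
  proof (cases "q \<le> p")
    case True
    then show ?thesis by (induction rule: dec_induct) (use F_up order_trans in blast)+
  next
    case False
    then have "p \<le> q" by simp
    then show ?thesis by (induction rule: inc_induct) (use F_down order_trans in blast)+
  qed
  then have "F q \<le> h_fun M (1 / s)" unfolding h_fun_def F_def by (intro cINF_greatest) auto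
  moreover have "h_fun M (1 / s) \<le> F q" unfolding F_def using pos s by (intro h_fun_le) auto
  ultimately show ?thesis by (simp add: F_def)
qed

text \<open>The minimality of \<open>M1 q * M2 r\<close> among all splittings of \<open>p = q + r\<close> says that
  \<open>s = min (M1 (q + 1) / M1 q) (M2 (r + 1) / M2 r)\<close> separates the quotients of both sequences at
  \<open>q\<close> and \<open>r\<close>, so both infima are attained there at \<open>t = 1 / s\<close>.\<close>

lemma conv_seq_h_fun_attained:
  assumes M1: "weight_sequence M1" and M2: "weight_sequence M2"
  obtains t where "0 < t" and "t \<le> 1 / min (M1 1) (M2 1)"
    and "h_fun (M1 \<star> M2) t = (M1 \<star> M2) p * t ^ p"
proof -
  have pos1: "0 < M1 p" and pos2: "0 < M2 p" for p
    using M1 M2 by (auto simp: weight_sequence_def)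
  have mono: "M 1 \<le> M (Suc p) / M p" if M: "weight_sequence M" for M p
  proof (induction p)
    case 0
    then show ?case using M by (simp add: weight_sequence_def)
  next
    case (Suc p)
    have "(M (Suc p))\<^sup>2 \<le> M p * M (Suc (Suc p))" "0 < M p" "0 < M (Suc p)"
      using M by (auto simp: weight_sequence_def dest: spec[of _ "Suc p"])
    then have "M (Suc p) / M p \<le> M (Suc (Suc p)) / M (Suc p)"
      by (simp add: divide_simps power2_eq_square mult.commute)
    then show ?case using Suc by linarith
  qed
  obtain q where q: "q \<le> p" and eq: "(M1 \<star> M2) p = M1 q * M2 (p - q)"
    by (rule conv_seq_attained)
  define r where "r = p - q"
  define s where "s = min (M1 (Suc q) / M1 q) (M2 (Suc r) / M2 r)"
  have min_le: "M1 q * M2 r \<le> M1 i * M2 (p - i)" if "i \<le> p" for i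
    using conv_seq_le[OF that, of M1 M2] by (simp add: eq r_def)
  have s: "0 < s" using pos1 pos2 by (simp add: s_def)
  \<comment> \<open>The bound by the quotient of \<open>M1\<close> is log-convexity. The bound by
    that of \<open>M2\<close> says that moving one index from \<open>M1\<close> to \<open>M2\<close>
    does not lower the minimal product. \<open>lo2\<close> is the mirror image.\<close>
  have lo1: "M1 q \<le> s * M1 (q - 1)" if "0 < q"
  proof -
    have "M1 q / M1 (q - 1) \<le> M1 (Suc q) / M1 q"
      using M1 that pos1[of q] pos1[of "q - 1"]
      by (simp add: weight_sequence_def divide_simps power2_eq_square mult.commute)
    moreover have "M1 q / M1 (q - 1) \<le> M2 (Suc r) / M2 r"
      using min_le[of "q - 1"] that q pos1[of "q - 1"] pos2[of r]
      by (simp add: r_def divide_simps Suc_diff_le mult.commute)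
    ultimately have "M1 q / M1 (q - 1) \<le> s" by (simp add: s_def)
    then show ?thesis using pos1[of "q - 1"] by (simp add: pos_divide_le_eq)
  qed
  have lo2: "M2 r \<le> s * M2 (r - 1)" if "0 < r"
  proof -
    have "M2 r / M2 (r - 1) \<le> M2 (Suc r) / M2 r"
      using M2 that pos2[of r] pos2[of "r - 1"]
      by (simp add: weight_sequence_def divide_simps power2_eq_square mult.commute)
    moreover have "p - Suc q = r - 1" by (simp add: r_def)
    then have "M2 r / M2 (r - 1) \<le> M1 (Suc q) / M1 q"
      using min_le[of "Suc q"] that q pos2[of "r - 1"] pos1[of q]
      by (simp add: r_def divide_simps mult.commute)
    ultimately have "M2 r / M2 (r - 1) \<le> s" by (simp add: s_def)
    then show ?thesis using pos2[of "r - 1"] by (simp add: pos_divide_le_eq)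
  qed
  have "h_fun M1 (1 / s) = M1 q * (1 / s) ^ q"
  proof (rule h_fun_eq_at_quotient[OF M1 s lo1])
    have "s \<le> M1 (Suc q) / M1 q" by (simp add: s_def)
    then show "s * M1 q \<le> M1 (q + 1)" using pos1[of q] by (simp add: pos_le_divide_eq)
  qed
  moreover have "h_fun M2 (1 / s) = M2 r * (1 / s) ^ r"
  proof (rule h_fun_eq_at_quotient[OF M2 s lo2])
    have "s \<le> M2 (Suc r) / M2 r" by (simp add: s_def)
    then show "s * M2 r \<le> M2 (r + 1)" using pos2[of r] by (simp add: pos_le_divide_eq)
  qed
  ultimately have "h_fun (M1 \<star> M2) (1 / s) = (M1 \<star> M2) p * ((1 / s) ^ q * (1 / s) ^ r)"
    using h_fun_conv_seq[of M1 M2 "1 / s"] pos1 pos2 s by (simp add: eq r_def)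
  also have "(1 / s) ^ q * (1 / s) ^ r = (1 / s) ^ p"
    using q by (simp only: r_def power_add[symmetric]) simp
  finally have "h_fun (M1 \<star> M2) (1 / s) = (M1 \<star> M2) p * (1 / s) ^ p" .
  \<comment> \<open>The quotients increase from \<open>M 1 / M 0 = M 1\<close>, so this bound holds
    whatever \<open>p\<close> is; uniformity in \<open>p\<close> is what later gives one constant
    for all moments.\<close>
  moreover have "1 / s \<le> 1 / min (M1 1) (M2 1)"
  proof (rule divide_left_mono)
    show "min (M1 1) (M2 1) \<le> s"
      unfolding s_def using mono[OF M1, of q] mono[OF M2, of r] by (rule min.mono)
    show "0 < s * min (M1 1) (M2 1)" using s pos1 pos2 by simp
  qed simp
  ultimately show thesis using s by (intro that[of "1 / s"]) auto
qed

section \<open>Integrals depending on a parameter, and power series remainders\<close>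

text \<open>Cauchy's inequality on discs of radius \<open>r / 4\<close> around the points of the
  half ball bounds the derivative by \<open>4 * B / r\<close>, and the mean value inequality on a
  convex set finishes. A bound on the function alone thus dominates its difference
  quotients.\<close>

lemma norm_diff_quotient_le:
  assumes hol: "f holomorphic_on ball w r" and r: "0 < r"
    and B: "\<And>z. z \<in> ball w r \<Longrightarrow> norm (f z) \<le> B"
    and y: "y \<in> ball w (r / 2)"
  shows "norm (f y - f w) \<le> 4 * B / r * norm (y - w)"
proof -
  have der: "norm (deriv f z) \<le> 4 * B / r" if z: "z \<in> ball w (r / 2)" for z
  proof -
    have sub: "cball z (r / 4) \<subseteq> ball w r"
    proof
      fix x assume "x \<in> cball z (r / 4)"
      then have "dist z x \<le> r / 4" by simp
      then have "dist w x \<le> dist w z + r / 4" using dist_triangle[of w x z] by linarith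
      then show "x \<in> ball w r" using z r by simp
    qed
    have "norm ((deriv ^^ 1) f z) \<le> fact 1 * B / (r / 4) ^ 1"
    proof (rule Cauchy_inequality)
      show "f holomorphic_on ball z (r / 4)"
        using hol sub by (meson ball_subset_cball holomorphic_on_subset order_trans)
      show "continuous_on (cball z (r / 4)) f"
        using hol sub holomorphic_on_imp_continuous_on holomorphic_on_subset by blast
      show "norm (f x) \<le> B" if "norm (z - x) = r / 4" for x
        using that sub by (intro B) (auto simp: dist_norm subset_iff)
    qed (use r in auto)
    then show ?thesis by (simp add: mult.commute)
  qed
  show ?thesis
  proof (rule field_differentiable_bound[of "ball w (r / 2)" f "deriv f"])
    fix z assume "z \<in> ball w (r / 2)"
    moreover have "ball w (r / 2) \<subseteq> ball w r" using r by (intro subset_ball) auto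
    ultimately show "(f has_field_derivative deriv f z) (at z within ball w (r / 2))"
      using hol by (meson holomorphic_derivI open_ball has_field_derivative_at_within subsetD)
  qed (use der y r in auto)
qed

text \<open>Dominated convergence is applied to the difference quotients: a local majorant
  \<open>H\<close> of \<open>F\<close> itself yields their majorant \<open>4 / r * H\<close> by
  \<open>norm_diff_quotient_le\<close>.\<close>

lemma holomorphic_on_lebesgue_integral:
  fixes F :: "complex \<Rightarrow> 'a \<Rightarrow> complex"
  assumes U: "open U"
    and hol: "\<And>u. u \<in> space M \<Longrightarrow> (\<lambda>w. F w u) holomorphic_on U"
    and meas: "\<And>w. w \<in> U \<Longrightarrow> F w \<in> borel_measurable M"
    and dom: "\<And>w. w \<in> U \<Longrightarrow> \<exists>r>0. \<exists>H. integrable M H \<and>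
        (\<forall>z\<in>ball w r \<inter> U. \<forall>u\<in>space M. norm (F z u) \<le> H u)"
  shows "(\<lambda>w. LINT u|M. F w u) holomorphic_on U"
proof -
  have "(\<lambda>w. LINT u|M. F w u) field_differentiable at w" if w: "w \<in> U" for w
  proof -
    obtain r0 H where r0: "0 < r0" and H: "integrable M H"
      and bound0: "\<And>z u. z \<in> ball w r0 \<inter> U \<Longrightarrow> u \<in> space M \<Longrightarrow> norm (F z u) \<le> H u"
      using dom[OF w] by blast
    obtain r1 where r1: "0 < r1" "ball w r1 \<subseteq> U" using U w by (meson open_contains_ball)
    define r where "r = min r0 r1"
    have r: "0 < r" "ball w r \<subseteq> U" using r0 r1 by (auto simp: r_def)
    have bound: "norm (F z u) \<le> H u" if "z \<in> ball w r" "u \<in> space M" for z u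
      using that r r0 by (intro bound0) (auto simp: r_def)
    have int: "integrable M (F z)" if "z \<in> ball w r" for z
      using that r bound[OF that] meas[of z]
      by (intro Bochner_Integration.integrable_bound[OF H]) (auto intro!: AE_I2 order_trans[OF _ abs_ge_self])
    define D where "D u = deriv (\<lambda>z. F z u) w" for u
    \<comment> \<open>Dominated convergence concerns sequences, so the limit is tested along
      sequences, shifted until they lie in the half ball.\<close>
    have lim: "((\<lambda>y. ((LINT u|M. F y u) - (LINT u|M. F w u)) / (y - w)) \<longlongrightarrow> (LINT u|M. D u)) (at w)"
      unfolding tendsto_at_iff_sequentially
    proof (intro allI impI)
      fix X :: "nat \<Rightarrow> complex"
      assume X: "\<forall>i. X i \<in> UNIV - {w}" "X \<longlonglongrightarrow> w"
      then have "\<forall>\<^sub>F n in sequentially. dist (X n) w < r / 2"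
        using r by (intro tendstoD) auto
      then obtain N where N: "\<And>n. N \<le> n \<Longrightarrow> X n \<in> ball w (r / 2)"
        by (auto simp: eventually_sequentially dist_commute)
      define Y where "Y n = X (n + N)" for n
      have Yb: "Y n \<in> ball w (r / 2)" and Yw: "Y n \<noteq> w" for n
        using N X by (auto simp: Y_def)
      have Yr: "Y n \<in> ball w r" for n using Yb[of n] r by auto
      have Y: "Y \<longlonglongrightarrow> w" unfolding Y_def using X by (intro LIMSEQ_ignore_initial_segment)
      define q where "q n u = (F (Y n) u - F w u) / (Y n - w)" for n u
      have q_lim: "(\<lambda>n. q n u) \<longlonglongrightarrow> D u" if u: "u \<in> space M" for u
      proof -
        have "((\<lambda>z. F z u) has_field_derivative D u) (at w)"
          unfolding D_def using hol[OF u] U w by (rule holomorphic_derivI)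
        then have "((\<lambda>y. (F y u - F w u) / (y - w)) \<longlongrightarrow> D u) (at w)"
          by (simp add: has_field_derivative_iff)
        then show ?thesis
          unfolding tendsto_at_iff_sequentially q_def using Y Yw by (auto simp: o_def)
      qed
      have q_meas: "q n \<in> borel_measurable M" for n
      proof -
        have [measurable]: "F (Y n) \<in> borel_measurable M" "F w \<in> borel_measurable M"
          using meas Yr[of n] r w by auto
        show ?thesis unfolding q_def by measurable
      qed
      have q_bound: "norm (q n u) \<le> 4 / r * H u" if u: "u \<in> space M" for n u
      proof -
        have "norm (F (Y n) u - F w u) \<le> 4 * H u / r * norm (Y n - w)"
          using hol[OF u] r bound[OF _ u] Yb
          by (intro norm_diff_quotient_le) (auto intro: holomorphic_on_subset)
        then show ?thesis using Yw[of n] by (simp add: q_def norm_divide pos_divide_le_eq)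
      qed
      have "(\<lambda>n. LINT u|M. q n u) \<longlonglongrightarrow> (LINT u|M. D u)"
      proof (rule integral_dominated_convergence)
        show "integrable M (\<lambda>u. 4 / r * H u)" using H by simp
        show "D \<in> borel_measurable M"
          using q_meas q_lim by (rule borel_measurable_LIMSEQ_metric)
      qed (use q_lim q_meas q_bound in auto)
      moreover have "(LINT u|M. q n u) = ((LINT u|M. F (Y n) u) - (LINT u|M. F w u)) / (Y n - w)" for n
        unfolding q_def using int[OF Yr[of n]] int[of w] r by simp
      ultimately have "(\<lambda>n. ((LINT u|M. F (X (n + N)) u) - (LINT u|M. F w u)) / (X (n + N) - w))
          \<longlonglongrightarrow> (LINT u|M. D u)"
        by (simp add: Y_def)
      then show "((\<lambda>y. ((LINT u|M. F y u) - (LINT u|M. F w u)) / (y - w)) \<circ> X) \<longlonglongrightarrow> (LINT u|M. D u)"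
        unfolding o_def by (rule LIMSEQ_offset)
    qed
    then show ?thesis
      unfolding field_differentiable_def has_field_derivative_iff by blast
  qed
  then show ?thesis using U by (simp add: holomorphic_on_open field_differentiable_def)
qed

text \<open>This is the profile of every majorant below, with \<open>r\<close> the modulus of
  \<open>z\<close> or a bound for it. Its mass is proportional to \<open>r\<close>, which the factor
  \<open>1 / z\<close> of the transform cancels.\<close>

lemma has_bochner_integral_inverse_1_plus_square_scaled:
  fixes r :: real
  assumes r: "0 < r"
  shows "has_bochner_integral lborel (\<lambda>u. 1 / (1 + (u / r)\<^sup>2)) (pi * r)"
proof -
  let ?f = "\<lambda>u::real. inverse (1 + u\<^sup>2)"
  have deriv: "\<And>x. (arctan has_real_derivative ?f x) (at x)"
    by (rule DERIV_arctan)
  have cont: "\<And>x. isCont ?f x"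
    by (intro continuous_intros) (auto simp: add_nonneg_eq_0_iff)
  have lims: "((arctan \<circ> real_of_ereal) \<longlongrightarrow> - (pi / 2)) (at_right (-\<infinity>))"
    "((arctan \<circ> real_of_ereal) \<longlongrightarrow> pi / 2) (at_left \<infinity>)"
    by (auto simp: ereal_tendsto_simps tendsto_arctan_at_bot tendsto_arctan_at_top)
  have "set_integrable lborel (einterval (-\<infinity>) \<infinity>) ?f"
    and "(LBINT x=-\<infinity>..\<infinity>. ?f x) = pi / 2 - - (pi / 2)"
    by (rule interval_integral_FTC_nonneg[of "-\<infinity>" \<infinity> arctan ?f, OF _ deriv cont _ lims]; simp)+
  then have "has_bochner_integral lborel ?f pi"
    by (simp add: has_bochner_integral_iff set_integrable_def interval_lebesgue_integral_def
        set_lebesgue_integral_def)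
  then show ?thesis
    using r by (subst lborel_has_bochner_integral_real_affine_iff[of r _ _ 0])
      (auto simp: divide_simps)
qed

text \<open>Below half the radius of convergence the tail of the series is estimated, beyond it the
  partial sum; both are dominated by the same multiple of \<open>u ^ N\<close>.\<close>

lemma truncated_power_series_remainder:
  fixes c :: "nat \<Rightarrow> complex" and u :: real
  assumes c: "\<And>k. norm (c k) \<le> C * \<rho> ^ k" and \<rho>: "0 < \<rho>" and u: "0 < u"
  shows "norm ((if u < 1 / (2 * \<rho>) then \<Sum>k. c k * of_real u ^ k else 0)
      - (\<Sum>k<N. c k * of_real u ^ k)) \<le> 2 * C * (2 * \<rho>) ^ N * u ^ N"
proof -
  have C: "0 \<le> C" using c[of 0] norm_ge_zero[of "c 0"] by (simp del: norm_ge_zero)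
  have term_le: "norm (c k * of_real u ^ k) \<le> C * (\<rho> * u) ^ k" for k
    using c[of k] u by (simp add: norm_mult norm_power power_mult_distrib mult_right_mono
        flip: mult.assoc)
  have rhs: "2 * C * (2 * \<rho>) ^ N * u ^ N = 2 * C * (2 * (\<rho> * u)) ^ N"
    by (simp add: power_mult_distrib)
  show ?thesis
  proof (cases "u < 1 / (2 * \<rho>)")
    case True
    define x where "x = \<rho> * u"
    have x: "0 < x" "x < 1 / 2" using True \<rho> u by (auto simp: x_def field_simps)
    have geo: "summable (\<lambda>k. C * x ^ k)" using x by (intro summable_mult summable_geometric) auto
    have sm: "summable (\<lambda>k. norm (c k * of_real u ^ k))"
      using geo term_le by (intro summable_comparison_test'[OF geo, of 0]) (auto simp: x_def)
    have "(\<Sum>k. c k * of_real u ^ k) - (\<Sum>k<N. c k * of_real u ^ k)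
        = (\<Sum>k. c (k + N) * of_real u ^ (k + N))"
      by (subst suminf_split_initial_segment[OF summable_norm_cancel[OF sm], of N]) simp
    also have "norm \<dots> \<le> (\<Sum>k. norm (c (k + N) * of_real u ^ (k + N)))"
      by (rule summable_norm[OF summable_ignore_initial_segment[OF sm]])
    also have "\<dots> \<le> (\<Sum>k. C * x ^ (k + N))"
      using term_le summable_ignore_initial_segment[OF sm] summable_ignore_initial_segment[OF geo]
      by (intro suminf_le) (auto simp: x_def)
    also have "\<dots> = C * x ^ N * (1 / (1 - x))"
      using x by (simp add: power_add suminf_mult suminf_geometric summable_geometric
          mult.assoc mult.commute[of _ "x ^ N"])
    also have "\<dots> \<le> C * (2 * x) ^ N * 2"
      using x C by (intro mult_mono mult_left_mono power_mono) (auto simp: field_simps)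
    finally show ?thesis using True by (simp only: rhs) (simp add: x_def mult_ac)
  next
    case False
    define x where "x = \<rho> * u"
    have x: "1 \<le> 2 * x" using False \<rho> u by (auto simp: x_def field_simps)
    have "norm (\<Sum>k<N. c k * of_real u ^ k) \<le> (\<Sum>k<N. C * x ^ k)"
      using term_le by (intro sum_norm_le) (auto simp: x_def)
    \<comment> \<open>Here \<open>1 \<le> 2 * x\<close>, so
      \<open>(2 * x) ^ k \<le> (2 * x) ^ N\<close>. Cutting at half the radius leaves the factor
      \<open>(1 / 2) ^ k\<close>, which keeps the sum below a bound independent of
      \<open>N\<close>.\<close>
    also have "\<dots> \<le> (\<Sum>k<N. C * (2 * x) ^ N * (1 / 2) ^ k)"
    proof (rule sum_mono)
      fix k assume "k \<in> {..<N}"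
      then have "(2 * x) ^ k \<le> (2 * x) ^ N" using x by (intro power_increasing) auto
      then have "x ^ k \<le> (2 * x) ^ N * (1 / 2) ^ k"
        by (simp add: power_mult_distrib power_divide field_simps)
      then show "C * x ^ k \<le> C * (2 * x) ^ N * (1 / 2) ^ k"
        using C by (simp add: mult.assoc mult_left_mono)
    qed
    also have "\<dots> = C * (2 * x) ^ N * (\<Sum>k<N. (1 / 2) ^ k)" by (simp add: sum_distrib_left)
    also have "(\<Sum>k<N. (1 / 2 :: real) ^ k) \<le> 2"
      by (simp add: sum_gp_strict)
    finally have "norm (\<Sum>k<N. c k * of_real u ^ k) \<le> C * (2 * x) ^ N * 2"
      using C x by (simp add: mult_left_mono)
    then show ?thesis using False by (simp only: rhs) (simp add: x_def mult_ac)
  qed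
qed

section \<open>The Laplace transform with an optimal flat kernel\<close>

locale flat_kernel =
  fixes M :: "nat \<Rightarrow> real" and \<gamma> :: real and G :: "log_point \<Rightarrow> complex"
    and K1 K2 K3 K4 :: real
  assumes M_pos: "0 < M p"
    and gamma_pos: "0 < \<gamma>"
    and K_pos: "0 < K1" "0 < K2" "0 < K3" "0 < K4"
    and hol: "G rs_holomorphic_on sector \<gamma>"
    and real: "0 < x \<Longrightarrow> G (x, 0) \<in> \<real>"
    and lower: "0 < x \<Longrightarrow> K1 * h_fun M (K2 * x) \<le> Re (G (x, 0))"
    and upper: "z \<in> sector \<gamma> \<Longrightarrow> norm (G z) \<le> K3 * h_fun M (K4 * rs_abs z)"
begin

text \<open>This is \<open>G (z / u)\<close> on the surface: dividing by a positive number changes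
  the modulus and keeps the argument. The value 0 elsewhere turns integrals over the half-line into
  integrals over \<open>lborel\<close>.\<close>

definition kernel :: "log_point \<Rightarrow> real \<Rightarrow> complex" where
  "kernel z u = (if 0 < u then G (rs_abs z / u, rs_arg z) else 0)"

definition laplace :: "(real \<Rightarrow> complex) \<Rightarrow> log_point \<Rightarrow> complex" where
  "laplace \<phi> z = inverse (rs_proj z) * (LINT u|lborel. kernel z u * \<phi> u)"

definition moment :: "nat \<Rightarrow> real" where
  "moment p = (LINT u|lborel. Re (kernel (1, 0) u) * u ^ p)"

text \<open>The constant that results in \<open>kernel_bound\<close> from estimating
  \<open>h_fun\<close> by its terms of index \<open>N\<close> and \<open>N + 2\<close>.\<close>

definition kernel_const :: "nat \<Rightarrow> real" where
  "kernel_const N = K3 * K4 ^ N * (M N + K4\<^sup>2 * M (N + 2))"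

lemma kernel_const_nonneg: "0 \<le> kernel_const N"
  using M_pos[of N] M_pos[of "N + 2"] K_pos by (simp add: kernel_const_def)

lemma sector_abs_pos: "z \<in> sector \<gamma> \<Longrightarrow> 0 < rs_abs z"
  by (simp add: sector_def log_surface_def)

lemma rs_exp_in_sector_iff: "rs_exp w \<in> sector \<gamma> \<longleftrightarrow> \<bar>Im w\<bar> < \<gamma> * pi / 2"
  by (simp add: sector_def log_surface_def rs_exp_def)

lemma kernel_rs_exp: "0 < u \<Longrightarrow> kernel (rs_exp w) u = G (rs_exp (w - of_real (ln u)))"
  by (simp add: kernel_def rs_exp_def exp_diff)

lemma holomorphic_strip: "(\<lambda>w. G (rs_exp w)) holomorphic_on {w. \<bar>Im w\<bar> < \<gamma> * pi / 2}"
  using hol by (simp add: rs_holomorphic_on_def vimage_def rs_exp_in_sector_iff)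

lemma open_strip: "open {w. \<bar>Im w\<bar> < \<gamma> * pi / 2}"
  by (intro open_Collect_less continuous_intros)

lemma convex_strip: "convex {w. \<bar>Im w\<bar> < \<gamma> * pi / 2}"
proof -
  have "{w. \<bar>Im w\<bar> < \<gamma> * pi / 2} = {w. Im w < \<gamma> * pi / 2} \<inter> {w. Im w > - (\<gamma> * pi / 2)}"
    by auto
  then show ?thesis
    by (simp only: convex_Int convex_halfspace_Im_lt convex_halfspace_Im_gt)
qed

lemma sector_eq_rs_exp:
  assumes "z \<in> sector \<gamma>"
  obtains w where "z = rs_exp w" and "\<bar>Im w\<bar> < \<gamma> * pi / 2"
proof -
  have "z = rs_exp (Complex (ln (rs_abs z)) (rs_arg z))"
    using sector_abs_pos[OF assms] by (simp add: rs_exp_def prod_eq_iff)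
  then show thesis using assms that rs_exp_in_sector_iff by metis
qed

lemma kernel_measurable:
  assumes z: "z \<in> sector \<gamma>"
  shows "kernel z \<in> borel_measurable borel"
proof -
  obtain w where w: "z = rs_exp w" "\<bar>Im w\<bar> < \<gamma> * pi / 2"
    using sector_eq_rs_exp[OF z] .
  have "continuous_on {0<..} (\<lambda>u. G (rs_exp (w - of_real (ln u))))"
    using w
    by (intro continuous_on_compose2[OF holomorphic_on_imp_continuous_on[OF holomorphic_strip]]
        continuous_intros) auto
  then have "(\<lambda>u. indicator {0<..} u *\<^sub>R G (rs_exp (w - of_real (ln u)))) \<in> borel_measurable borel"
    by (intro borel_measurable_continuous_on_indicator) auto
  also have "(\<lambda>u. indicator {0<..} u *\<^sub>R G (rs_exp (w - of_real (ln u)))) = kernel z"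
  proof
    fix u show "indicator {0<..} u *\<^sub>R G (rs_exp (w - of_real (ln u))) = kernel z u"
      by (cases "0 < u") (simp add: w kernel_rs_exp, simp add: kernel_def)
  qed
  finally show ?thesis .
qed

text \<open>The infimum is at most its term of index \<open>p\<close>, chosen so that its power of
  \<open>1 / u\<close> cancels \<open>u ^ p\<close>.\<close>

lemma kernel_power_bound:
  assumes z: "z \<in> sector \<gamma>" and u: "0 < u"
  shows "norm (kernel z u) * u ^ p \<le> K3 * M p * K4 ^ p * rs_abs z ^ p"
proof -
  have r: "0 < rs_abs z" by (rule sector_abs_pos[OF z])
  have "(rs_abs z / u, rs_arg z) \<in> sector \<gamma>"
    using z u by (auto simp: sector_def log_surface_def)
  then have "norm (kernel z u) \<le> K3 * h_fun M (K4 * (rs_abs z / u))"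
    using upper u by (fastforce simp: kernel_def)
  also have "\<dots> \<le> K3 * (M p * (K4 * (rs_abs z / u)) ^ p)"
    using K_pos r u M_pos by (intro mult_left_mono h_fun_le) auto
  finally show ?thesis
    using u by (simp add: power_mult_distrib power_divide field_simps)
qed

text \<open>Adding \<open>kernel_power_bound\<close> for \<open>N\<close> and, divided by the
  squared modulus, for \<open>N + 2\<close> produces the factor
  \<open>1 + (u / rs_abs z)\<^sup>2\<close>, that is, integrable decay.\<close>

lemma kernel_bound:
  assumes z: "z \<in> sector \<gamma>" and u: "0 < u"
  shows "norm (kernel z u) * u ^ N
    \<le> kernel_const N * rs_abs z ^ N * (1 / (1 + (u / rs_abs z)\<^sup>2))"
proof -
  let ?r = "rs_abs z"
  have r: "0 < ?r" by (rule sector_abs_pos[OF z])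
  have "norm (kernel z u) * u ^ N * (1 + (u / ?r)\<^sup>2)
      = norm (kernel z u) * u ^ N + norm (kernel z u) * u ^ (N + 2) / ?r\<^sup>2"
    by (simp add: algebra_simps power_divide power_add power2_eq_square)
  also have "\<dots> \<le> K3 * M N * K4 ^ N * ?r ^ N + K3 * M (N + 2) * K4 ^ (N + 2) * ?r ^ (N + 2) / ?r\<^sup>2"
    by (intro add_mono divide_right_mono kernel_power_bound[OF z u]) simp
  also have "\<dots> = kernel_const N * ?r ^ N"
    using r by (simp add: kernel_const_def algebra_simps power_add power2_eq_square)
  finally have le: "norm (kernel z u) * u ^ N * (1 + (u / ?r)\<^sup>2) \<le> kernel_const N * ?r ^ N" .
  have "0 < 1 + (u / ?r)\<^sup>2" by (simp add: add_pos_nonneg)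
  with le show ?thesis by (simp add: pos_le_divide_eq)
qed

text \<open>Three kinds of \<open>\<phi>\<close> occur: powers (\<open>N = p\<close>), the truncated
  series (\<open>N = 0\<close>), and the truncated series minus a partial sum (\<open>N\<close> its
  number of terms).\<close>

context
  fixes \<phi> :: "real \<Rightarrow> complex" and C :: real and N :: nat
  assumes phi_measurable: "\<phi> \<in> borel_measurable borel"
    and phi_bound: "\<And>u. 0 < u \<Longrightarrow> norm (\<phi> u) \<le> C * u ^ N"
begin

lemma phi_const_nonneg: "0 \<le> C"
  using phi_bound[of 1] norm_ge_zero[of "\<phi> 1"] by (simp del: norm_ge_zero)

lemma integrand_bound:
  assumes z: "z \<in> sector \<gamma>"
  shows "norm (kernel z u * \<phi> u)
    \<le> C * kernel_const N * rs_abs z ^ N * (1 / (1 + (u / rs_abs z)\<^sup>2))"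
proof (cases "0 < u")
  case True
  have "norm (kernel z u * \<phi> u) \<le> norm (kernel z u) * (C * u ^ N)"
    unfolding norm_mult using phi_bound[OF True] by (intro mult_left_mono) auto
  also have "\<dots> = C * (norm (kernel z u) * u ^ N)" by simp
  also have "\<dots> \<le> C * (kernel_const N * rs_abs z ^ N * (1 / (1 + (u / rs_abs z)\<^sup>2)))"
    by (intro mult_left_mono kernel_bound z True phi_const_nonneg)
  finally show ?thesis by (simp only: mult.assoc)
next
  case False
  have "0 \<le> C * kernel_const N * rs_abs z ^ N * (1 / (1 + (u / rs_abs z)\<^sup>2))"
    using phi_const_nonneg kernel_const_nonneg sector_abs_pos[OF z]
    by (intro mult_nonneg_nonneg) auto
  then show ?thesis using False by (simp add: kernel_def)
qed

lemma integrand_measurable: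
  assumes "z \<in> sector \<gamma>"
  shows "(\<lambda>u. kernel z u * \<phi> u) \<in> borel_measurable lborel"
  using kernel_measurable[OF assms] phi_measurable by simp

lemma integrand_integrable:
  assumes z: "z \<in> sector \<gamma>"
  shows "integrable lborel (\<lambda>u. kernel z u * \<phi> u)"
proof (rule Bochner_Integration.integrable_bound)
  show "integrable lborel (\<lambda>u. C * kernel_const N * rs_abs z ^ N * (1 / (1 + (u / rs_abs z)\<^sup>2)))"
    using has_bochner_integral_inverse_1_plus_square_scaled[OF sector_abs_pos[OF z]]
    by (intro integrable_mult_right) (simp add: has_bochner_integral_iff)
  show "AE u in lborel. norm (kernel z u * \<phi> u)
      \<le> norm (C * kernel_const N * rs_abs z ^ N * (1 / (1 + (u / rs_abs z)\<^sup>2)))"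
    using integrand_bound[OF z] by (intro AE_I2) (metis abs_ge_self order_trans real_norm_def)
qed (rule integrand_measurable[OF z])

lemma norm_laplace_le:
  assumes z: "z \<in> sector \<gamma>"
  shows "norm (laplace \<phi> z) \<le> C * kernel_const N * pi * rs_abs z ^ N"
proof -
  let ?r = "rs_abs z"
  have r: "0 < ?r" by (rule sector_abs_pos[OF z])
  note sq = has_bochner_integral_inverse_1_plus_square_scaled[OF r]
  have "norm (LINT u|lborel. kernel z u * \<phi> u)
      \<le> (LINT u|lborel. C * kernel_const N * ?r ^ N * (1 / (1 + (u / ?r)\<^sup>2)))"
    using integrand_bound[OF z] integrand_integrable[OF z] sq
    by (intro Bochner_Integration.integral_norm_bound_integral integrable_mult_right) (auto simp: has_bochner_integral_iff)
  also have "\<dots> = C * kernel_const N * ?r ^ N * (pi * ?r)"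
    using has_bochner_integral_integral_eq[OF has_bochner_integral_mult_right[OF sq]] by blast
  finally have "norm (LINT u|lborel. kernel z u * \<phi> u) \<le> C * kernel_const N * ?r ^ N * (pi * ?r)" .
  moreover have "norm (rs_proj z) = ?r"
    using r by (intro norm_rs_proj) (simp add: log_surface_def)
  then have "norm (laplace \<phi> z) = norm (LINT u|lborel. kernel z u * \<phi> u) / ?r"
    by (simp add: laplace_def norm_mult norm_inverse divide_inverse mult.commute)
  ultimately show ?thesis
    using r by (simp only: pos_divide_le_eq mult_ac)
qed

lemma integral_holomorphic:
  "(\<lambda>w. LINT u|lborel. kernel (rs_exp w) u * \<phi> u) holomorphic_on {w. \<bar>Im w\<bar> < \<gamma> * pi / 2}"
    (is "_ holomorphic_on ?U")
proof (rule holomorphic_on_lebesgue_integral[OF open_strip])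
  fix u :: real
  show "(\<lambda>w. kernel (rs_exp w) u * \<phi> u) holomorphic_on ?U"
  proof (cases "0 < u")
    case True
    have "((\<lambda>w. G (rs_exp w)) \<circ> (\<lambda>w. w - of_real (ln u))) holomorphic_on ?U"
      by (intro holomorphic_on_compose_gen[OF _ holomorphic_strip] holomorphic_intros) auto
    then show ?thesis
      using True by (auto simp: kernel_rs_exp o_def intro: holomorphic_intros)
  qed (simp add: kernel_def)
next
  fix w assume "w \<in> ?U"
  then show "(\<lambda>u. kernel (rs_exp w) u * \<phi> u) \<in> borel_measurable lborel"
    by (intro integrand_measurable) (simp add: rs_exp_in_sector_iff)
  \<comment> \<open>The majorant of \<open>integrand_bound\<close> increases with the modulus, so on
    the unit ball around \<open>w\<close> in the chart its value at the largest modulus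
    \<open>R\<close> dominates.\<close>
  define R where "R = exp (Re w + 1)"
  have R: "0 < R" by (simp add: R_def)
  define H where "H u = C * kernel_const N * R ^ N * (1 / (1 + (u / R)\<^sup>2))" for u
  have "integrable lborel H"
    unfolding H_def using has_bochner_integral_inverse_1_plus_square_scaled[OF R]
    by (intro integrable_mult_right) (simp add: has_bochner_integral_iff)
  moreover have "norm (kernel (rs_exp z) u * \<phi> u) \<le> H u" if z: "z \<in> ball w 1 \<inter> ?U" for z u
  proof -
    define r where "r = exp (Re z)"
    have "\<bar>Re z - Re w\<bar> < 1"
      using z abs_Re_le_cmod[of "z - w"] by (auto simp: dist_norm norm_minus_commute)
    then have r: "0 < r" "r \<le> R" by (auto simp: r_def R_def)
    have "norm (kernel (rs_exp z) u * \<phi> u) \<le> C * kernel_const N * r ^ N * (1 / (1 + (u / r)\<^sup>2))"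
      using integrand_bound[of "rs_exp z" u] z by (simp add: rs_exp_in_sector_iff) (simp add: rs_exp_def r_def)
    also have "\<dots> \<le> C * kernel_const N * R ^ N * (1 / (1 + (u / R)\<^sup>2))"
    proof (rule mult_mono)
      show "C * kernel_const N * r ^ N \<le> C * kernel_const N * R ^ N"
        using r phi_const_nonneg kernel_const_nonneg by (intro mult_left_mono power_mono) auto
      have "(u / R)\<^sup>2 \<le> (u / r)\<^sup>2"
        using r by (simp add: power_divide frac_le power_mono)
      then show "1 / (1 + (u / r)\<^sup>2) \<le> 1 / (1 + (u / R)\<^sup>2)"
        by (intro divide_left_mono mult_pos_pos add_pos_nonneg) auto
    qed (use R phi_const_nonneg kernel_const_nonneg in auto)
    finally show ?thesis by (simp add: H_def)
  qed
  ultimately show "\<exists>r>0. \<exists>H. integrable lborel H \<and>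
      (\<forall>z\<in>ball w r \<inter> ?U. \<forall>u\<in>space lborel. norm (kernel (rs_exp z) u * \<phi> u) \<le> H u)"
    by (intro exI[of _ 1] conjI exI[of _ H]) auto
qed

lemma laplace_holomorphic: "laplace \<phi> rs_holomorphic_on sector \<gamma>"
  using integral_holomorphic
  by (auto simp: rs_holomorphic_on_def laplace_def rs_proj_exp vimage_def rs_exp_in_sector_iff
      intro!: holomorphic_intros)

end

end

section \<open>Moments of the kernel and the transform of powers\<close>

context flat_kernel
begin

lemma pos_real_in_sector: "0 < x \<Longrightarrow> (x, 0) \<in> sector \<gamma>"
  using gamma_pos by (simp add: sector_def log_surface_def)

lemma kernel_real: "0 < x \<Longrightarrow> kernel (x, 0) u = of_real (Re (kernel (x, 0) u))"
  using real[of "x / u"] by (simp add: kernel_def of_real_Re)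

lemma Re_kernel_ge: "0 < u \<Longrightarrow> K1 * h_fun M (K2 / u) \<le> Re (kernel (1, 0) u)"
  using lower[of "1 / u"] by (simp add: kernel_def)

lemma Re_kernel_nonneg: "0 \<le> Re (kernel (1, 0) u)"
proof (cases "0 < u")
  case True
  have "0 \<le> K1 * h_fun M (K2 / u)"
    using K_pos True M_pos by (intro mult_nonneg_nonneg h_fun_nonneg) auto
  then show ?thesis using Re_kernel_ge[OF True] by linarith
qed (simp add: kernel_def)

lemma power_integrand_integrable:
  "z \<in> sector \<gamma> \<Longrightarrow> integrable lborel (\<lambda>u. kernel z u * of_real u ^ p)"
  by (rule integrand_integrable[where C = 1 and N = p]) (auto simp: norm_power)

lemma moment_integrand_integrable: "integrable lborel (\<lambda>u. Re (kernel (1, 0) u) * u ^ p)"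
proof -
  have "(\<lambda>u. Re (kernel (1, 0) u * of_real u ^ p)) = (\<lambda>u. Re (kernel (1, 0) u) * u ^ p)"
    by (simp flip: of_real_power)
  then show ?thesis
    using integrable_Re[OF power_integrand_integrable[OF pos_real_in_sector[of 1], of p]] by simp
qed

lemma of_real_moment: "of_real (moment p) = (LINT u|lborel. kernel (1, 0) u * of_real u ^ p)"
proof -
  have "(\<lambda>u. kernel (1, 0) u * of_real u ^ p)
      = (\<lambda>u. of_real (Re (kernel (1, 0) u) * u ^ p))"
    by (subst kernel_real) auto
  then show ?thesis unfolding moment_def by (simp only: integral_complex_of_real)
qed

text \<open>On the positive axis this is the substitution \<open>u = x v\<close>; the identity theorem on the
  strip \<open>log ` sector \<gamma>\<close> replaces the rotation of the path of integration.\<close>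

lemma integral_kernel_power:
  assumes z: "z \<in> sector \<gamma>"
  shows "(LINT u|lborel. kernel z u * of_real u ^ p) = rs_proj z ^ Suc p * of_real (moment p)"
proof -
  let ?U = "{w. \<bar>Im w\<bar> < \<gamma> * pi / 2}"
  define F where "F w = (LINT u|lborel. kernel (rs_exp w) u * of_real u ^ p)
    - exp w ^ Suc p * of_real (moment p)" for w
  obtain w where w: "z = rs_exp w" "w \<in> ?U"
    using sector_eq_rs_exp[OF z] by auto
  have on_real: "F (of_real x) = 0" for x
  proof -
    \<comment> \<open>The summand 0 matches the affine substitution rule. The Jacobian
      \<open>exp x\<close> joins the \<open>p\<close> factors from the integrand, which explains the
      exponent \<open>Suc p\<close>.\<close>
    have scale: "kernel (rs_exp (of_real x)) (0 + exp x * v) = kernel (1, 0) v" for v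
      by (simp add: kernel_def rs_exp_def zero_less_mult_iff)
    have "(LINT u|lborel. kernel (rs_exp (of_real x)) u * of_real u ^ p)
        = exp x *\<^sub>R (LINT v|lborel. kernel (rs_exp (of_real x)) (0 + exp x * v) * of_real (0 + exp x * v) ^ p)"
      by (subst lborel_integral_real_affine[of "exp x" _ 0]) auto
    also have "\<dots> = exp x *\<^sub>R (LINT v|lborel. of_real (exp x) ^ p * (kernel (1, 0) v * of_real v ^ p))"
      by (simp only: scale) (simp add: power_mult_distrib mult_ac)
    also have "\<dots> = exp x *\<^sub>R (of_real (exp x) ^ p * of_real (moment p))"
      by (simp only: integral_mult_right_zero of_real_moment)
    finally show ?thesis
      by (simp add: F_def scaleR_conv_of_real exp_of_real)
  qed
  have "F w = 0"
  proof (rule analytic_continuation[of F ?U "range of_real" 0])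
    show "F holomorphic_on ?U"
      unfolding F_def
      by (intro holomorphic_intros integral_holomorphic[where C = 1 and N = p])
        (auto simp: norm_power)
    show "connected ?U" using convex_strip by (rule convex_connected)
    show "range of_real \<subseteq> ?U" "0 \<in> ?U" using gamma_pos by auto
    show "(0::complex) islimpt range of_real"
      unfolding islimpt_approachable
    proof (intro allI impI)
      fix e :: real assume "0 < e"
      then show "\<exists>x'\<in>range of_real. x' \<noteq> (0::complex) \<and> dist x' 0 < e"
        by (intro bexI[OF _ rangeI[of of_real "e / 2"]]) (auto simp: norm_divide)
    qed
  qed (use on_real open_strip w in auto)
  then show ?thesis by (simp add: F_def w rs_proj_exp)
qed

lemma laplace_power:
  assumes z: "z \<in> sector \<gamma>"
  shows "laplace (\<lambda>u. of_real u ^ p) z = rs_proj z ^ p * of_real (moment p)"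
proof -
  have "norm (rs_proj z) = rs_abs z" "0 < rs_abs z"
    using sector_abs_pos[OF z] by (auto intro: norm_rs_proj simp: log_surface_def)
  then have "rs_proj z \<noteq> 0" by auto
  then show ?thesis by (simp add: laplace_def integral_kernel_power[OF z])
qed

text \<open>For \<open>0 < u \<le> K2 / t\<close> the argument \<open>K2 / u\<close> is at least
  \<open>t\<close>, so the kernel is at least \<open>K1 * h_fun M t\<close>. Integrating
  \<open>u ^ p\<close> over this interval gives a power of \<open>1 / t\<close> which, by
  \<open>attained\<close>, cancels \<open>t ^ p\<close> and leaves a single \<open>1 / t\<close>,
  bounded below by \<open>1 / T\<close>.\<close>

lemma moment_ge:
  assumes t: "0 < t" "t \<le> T" and attained: "M p * t ^ p \<le> h_fun M t"
  shows "K1 * K2 / T * (K2 / 2) ^ p * M p \<le> moment p"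
proof -
  define X where "X = K2 / t"
  have X: "0 < X" using K_pos t by (simp add: X_def)
  \<comment> \<open>At \<open>u = 0\<close> the kernel is 0 by convention while \<open>u ^ p\<close>
    is 1 for \<open>p = 0\<close>, so this point has to be left out as a null set.\<close>
  have "K1 * h_fun M t * (u ^ p * indicator {0..X} u) \<le> Re (kernel (1, 0) u) * u ^ p" if "u \<noteq> 0" for u
  proof (cases "u \<in> {0..X}")
    case True
    then have u: "0 < u" using that by simp
    then have "t \<le> K2 / u" using True t K_pos by (simp add: X_def field_simps)
    then have "h_fun M t \<le> h_fun M (K2 / u)" using M_pos t by (intro h_fun_mono) auto
    then have "K1 * h_fun M t \<le> K1 * h_fun M (K2 / u)" using K_pos by (intro mult_left_mono) auto
    then have "K1 * h_fun M t \<le> Re (kernel (1, 0) u)" using Re_kernel_ge[OF u] by linarith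
    then show ?thesis using True u by (simp add: mult_right_mono)
  next
    case False
    have "0 \<le> Re (kernel (1, 0) u) * u ^ p"
    proof (cases "0 < u")
      case True
      then show ?thesis using Re_kernel_nonneg by simp
    qed (simp add: kernel_def)
    then show ?thesis using False by simp
  qed
  then have pointwise: "AE u in lborel. K1 * h_fun M t * (u ^ p * indicator {0..X} u)
      \<le> Re (kernel (1, 0) u) * u ^ p"
    using AE_lborel_singleton[of 0] by auto
  have "integrable lborel (\<lambda>u. u ^ p * indicator {0..X} u)"
    using borel_integrable_compact[of "{0..X}" "\<lambda>u. u ^ p"]
    by (simp add: continuous_intros mult.commute)
  then have "(LINT u|lborel. K1 * h_fun M t * (u ^ p * indicator {0..X} u)) \<le> moment p"
    unfolding moment_def using pointwise
    by (intro integral_mono_AE moment_integrand_integrable integrable_mult_right)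
  also have "(LINT u|lborel. K1 * h_fun M t * (u ^ p * indicator {0..X} u))
      = K1 * h_fun M t * (X ^ Suc p / Suc p)"
    using X integral_power[of 0 X p] by (simp add: power_0_left)
  finally have le: "K1 * h_fun M t * (X ^ Suc p / Suc p) \<le> moment p" .
  \<comment> \<open>The denominator \<open>Suc p\<close> from integrating \<open>u ^ p\<close> is
    absorbed into the geometric rate, which becomes \<open>K2 / 2\<close>.\<close>
  have "real (Suc p) \<le> 2 ^ p"
    using Suc_leI[OF less_exp[of p]] of_nat_mono by fastforce
  then have "K2 ^ Suc p / (t * 2 ^ p) \<le> K2 ^ Suc p / (t * Suc p)"
    using K_pos t by (intro divide_left_mono mult_left_mono) auto
  moreover have "K2 ^ Suc p / (T * 2 ^ p) \<le> K2 ^ Suc p / (t * 2 ^ p)"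
    using K_pos t by (intro divide_left_mono mult_right_mono) auto
  ultimately have "K1 * M p * (K2 ^ Suc p / (T * 2 ^ p)) \<le> K1 * M p * (K2 ^ Suc p / (t * Suc p))"
    using K_pos M_pos[of p] by (intro mult_left_mono) auto
  also have "\<dots> = K1 * (M p * t ^ p) * (X ^ Suc p / Suc p)"
    using t by (simp add: X_def power_divide)
  also have "\<dots> \<le> K1 * h_fun M t * (X ^ Suc p / Suc p)"
    using attained K_pos X by (intro mult_right_mono mult_left_mono) auto
  finally have "K1 * M p * (K2 ^ Suc p / (T * 2 ^ p)) \<le> moment p" using le by linarith
  then show ?thesis using t by (simp add: power_divide mult_ac)
qed

end

section \<open>Right inverses of the Borel map\<close>

lemma fps_space_bound:
  assumes M: "\<And>p. 0 < M p" and A: "0 < A" and a: "a \<in> fps_space M A"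
  shows "norm (fps_nth a p) \<le> fps_space_norm M A a * A ^ p * M p"
proof -
  have "norm (fps_nth a p) / (A ^ p * M p) \<le> fps_space_norm M A a"
    using a unfolding fps_space_norm_def fps_space_def
    by (intro cSup_upper) (auto simp: fps_quotients_def)
  moreover have "0 < A ^ p * M p" using A M by simp
  ultimately show ?thesis by (simp add: pos_divide_le_eq mult.assoc)
qed

lemma fps_spaceI:
  assumes M: "\<And>p. 0 < M p" and A: "0 < A"
    and bound: "\<And>p. norm (fps_nth a p) \<le> C * A ^ p * M p"
  shows "a \<in> fps_space M A"
proof -
  have "norm (fps_nth a p) / (A ^ p * M p) \<le> C" for p
  proof -
    have "0 < A ^ p * M p" using A M by simp
    then show ?thesis using bound[of p] by (simp add: pos_divide_le_eq mult.assoc)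
  qed
  then show ?thesis unfolding fps_space_def fps_quotients_def by (auto intro!: bdd_aboveI)
qed

lemma fps_space_norm_nonneg:
  assumes M: "\<And>p. 0 < M p" and A: "0 < A" and a: "a \<in> fps_space M A"
  shows "0 \<le> fps_space_norm M A a"
proof -
  have "0 \<le> fps_space_norm M A a * A ^ 0 * M 0"
    using fps_space_bound[of M A a 0, OF M A a] norm_ge_zero[of "fps_nth a 0"] by linarith
  then show ?thesis using M[of 0] by (simp add: zero_le_mult_iff)
qed

lemma fps_space_diff:
  assumes M: "\<And>p. 0 < M p" and A: "0 < A" and a: "a \<in> fps_space M A" and b: "b \<in> fps_space M A"
  shows "b - a \<in> fps_space M A"
proof (rule fps_spaceI[where C = "fps_space_norm M A b + fps_space_norm M A a", OF M A])
  fix p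
  have "norm (fps_nth (b - a) p) \<le> norm (fps_nth b p) + norm (fps_nth a p)"
    by (simp add: norm_triangle_ineq4)
  also have "\<dots> \<le> fps_space_norm M A b * A ^ p * M p + fps_space_norm M A a * A ^ p * M p"
    by (intro add_mono fps_space_bound[of M A, OF M A] a b)
  finally show "norm (fps_nth (b - a) p)
      \<le> (fps_space_norm M A b + fps_space_norm M A a) * A ^ p * M p"
    by (simp add: algebra_simps)
qed

text \<open>One estimate does both jobs: finiteness of the quotients of \<open>T a\<close> against
  \<open>a\<close> identifies \<open>a\<close> as the expansion, by uniqueness, and their bound by a
  multiple of the norm of \<open>a\<close> gives continuity of the linear map.\<close>

lemma bounded_right_inverse_of_borel_map:
  assumes M: "\<And>p. 0 < M p" and A: "0 < A" and B: "0 < B" and \<gamma>: "0 < \<gamma>"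
    and lin: "linear_map_on (fps_space M A) (sector \<gamma>) T"
    and hol: "\<And>a. a \<in> fps_space M A \<Longrightarrow> T a rs_holomorphic_on sector \<gamma>"
    and bound: "\<And>a y. a \<in> fps_space M A \<Longrightarrow> y \<in> asymp_quotients M B (sector \<gamma>) (T a) a \<Longrightarrow>
        y \<le> L * fps_space_norm M A a"
  shows "linear_continuous_map M A B (sector \<gamma>) T \<and>
    (\<forall>a\<in>fps_space M A. borel_map M B (sector \<gamma>) (T a) = a)"
proof -
  let ?V = "fps_space M A" and ?S = "sector \<gamma>"
  have bdd: "bdd_above (asymp_quotients M B ?S (T a) a)" if "a \<in> ?V" for a
    using bound[OF that] by (rule bdd_aboveI)
  have borel_eq: "borel_map M B ?S f = a" if "bdd_above (asymp_quotients M B ?S f a)" for f a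
    unfolding borel_map_def
    using that by (rule the_equality) (rule asymp_expansion_unique[OF M B \<gamma> _ that])
  have maps: "T ` ?V \<subseteq> asymp_space M B ?S"
  proof (rule image_subsetI)
    fix a assume "a \<in> ?V"
    with hol bdd[of a] show "T a \<in> asymp_space M B ?S"
      unfolding asymp_space_def by (intro CollectI conjI exI[of _ a]) simp_all
  qed
  have cont: "\<exists>\<delta>>0. \<forall>b\<in>?V. fps_space_norm M A (b - a) < \<delta> \<longrightarrow>
      asymp_space_norm M B ?S (\<lambda>z. T b z - T a z) < \<epsilon>" if a: "a \<in> ?V" and e: "0 < \<epsilon>" for a \<epsilon>
  \<comment> \<open>\<open>L\<close> may be zero or negative; \<open>\<bar>L\<bar> + 1\<close> is a
    positive bound for it.\<close>
  proof (intro exI[of _ "\<epsilon> / (\<bar>L\<bar> + 1)"] conjI ballI impI)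
    show "0 < \<epsilon> / (\<bar>L\<bar> + 1)" using e by simp
    fix b assume b: "b \<in> ?V" and small: "fps_space_norm M A (b - a) < \<epsilon> / (\<bar>L\<bar> + 1)"
    have d: "b - a \<in> ?V" by (rule fps_space_diff[of M, OF M A a b])
    \<comment> \<open>Linearity is known on the sector only, which suffices because the quotients
      see a function only through its values there.\<close>
    have "T b z - T a z = T (b - a) z" if "z \<in> ?S" for z
    proof -
      have "T ((b - a) + a) z = T (b - a) z + T a z"
        using lin d a that unfolding linear_map_on_def by blast
      then show ?thesis by simp
    qed
    then have quot: "asymp_quotients M B ?S (\<lambda>z. T b z - T a z) (b - a)
        = asymp_quotients M B ?S (T (b - a)) (b - a)"
      unfolding asymp_quotients_def by (intro image_cong) auto
    have "asymp_space_norm M B ?S (\<lambda>z. T b z - T a z)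
        = Sup (asymp_quotients M B ?S (T (b - a)) (b - a))"
      unfolding asymp_space_norm_def using borel_eq[of "\<lambda>z. T b z - T a z" "b - a"] bdd[OF d] quot
      by simp
    also have "\<dots> \<le> L * fps_space_norm M A (b - a)"
    proof (rule cSup_least)
      have "(1, 0) \<in> ?S" using \<gamma> by (simp add: sector_def log_surface_def)
      then show "asymp_quotients M B ?S (T (b - a)) (b - a) \<noteq> {}"
        unfolding asymp_quotients_def by auto
    qed (rule bound[OF d])
    also have "\<dots> \<le> (\<bar>L\<bar> + 1) * fps_space_norm M A (b - a)"
      by (intro mult_right_mono fps_space_norm_nonneg[of M, OF M A d]) linarith
    also have "\<dots> < \<epsilon>" using small by (simp add: pos_less_divide_eq mult.commute add_nonneg_pos)
    finally show "asymp_space_norm M B ?S (\<lambda>z. T b z - T a z) < \<epsilon>" .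
  qed
  then show ?thesis
    unfolding linear_continuous_map_def
    by (intro conjI ballI allI impI maps lin cont borel_eq[OF bdd])
qed

section \<open>The extension operator and its remainder estimates\<close>

context flat_kernel
begin

lemma laplace_cong: "(\<And>u. 0 < u \<Longrightarrow> \<phi> u = \<psi> u) \<Longrightarrow> laplace \<phi> z = laplace \<psi> z"
proof -
  assume eq: "\<And>u. 0 < u \<Longrightarrow> \<phi> u = \<psi> u"
  have "kernel z u * \<phi> u = kernel z u * \<psi> u" for u
    by (cases "0 < u") (simp add: eq, simp add: kernel_def)
  then have "(\<lambda>u. kernel z u * \<phi> u) = (\<lambda>u. kernel z u * \<psi> u)" by (rule ext)
  then show ?thesis by (simp only: laplace_def)
qed

lemma laplace_mult_right: "laplace (\<lambda>u. c * \<phi> u) z = c * laplace \<phi> z"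
proof -
  have "(LINT u|lborel. kernel z u * (c * \<phi> u)) = c * (LINT u|lborel. kernel z u * \<phi> u)"
    by (subst integral_mult_right_zero[symmetric]) (simp add: mult_ac)
  then show ?thesis by (simp add: laplace_def)
qed

lemma laplace_add:
  assumes "integrable lborel (\<lambda>u. kernel z u * \<phi> u)" and "integrable lborel (\<lambda>u. kernel z u * \<psi> u)"
  shows "laplace (\<lambda>u. \<phi> u + \<psi> u) z = laplace \<phi> z + laplace \<psi> z"
  using assms by (simp add: laplace_def distrib_left)

lemma laplace_diff:
  assumes "integrable lborel (\<lambda>u. kernel z u * \<phi> u)" and "integrable lborel (\<lambda>u. kernel z u * \<psi> u)"
  shows "laplace (\<lambda>u. \<phi> u - \<psi> u) z = laplace \<phi> z - laplace \<psi> z"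
  using assms by (simp add: laplace_def right_diff_distrib)

lemma laplace_polynomial:
  assumes z: "z \<in> sector \<gamma>"
  shows "integrable lborel (\<lambda>u. kernel z u * (\<Sum>k<N. c k * of_real u ^ k))"
    and "laplace (\<lambda>u. \<Sum>k<N. c k * of_real u ^ k) z = (\<Sum>k<N. c k * of_real (moment k) * rs_proj z ^ k)"
proof -
  have int: "integrable lborel (\<lambda>u. kernel z u * (c k * of_real u ^ k))" for k
    using integrable_mult_right[OF power_integrand_integrable[OF z, of k], of "c k"]
    by (simp add: mult_ac)
  then show "integrable lborel (\<lambda>u. kernel z u * (\<Sum>k<N. c k * of_real u ^ k))"
    by (simp add: sum_distrib_left)
  have "laplace (\<lambda>u. \<Sum>k<N. c k * of_real u ^ k) z = (\<Sum>k<N. laplace (\<lambda>u. c k * of_real u ^ k) z)"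
    using int by (simp add: laplace_def sum_distrib_left)
  then show "laplace (\<lambda>u. \<Sum>k<N. c k * of_real u ^ k) z = (\<Sum>k<N. c k * of_real (moment k) * rs_proj z ^ k)"
    by (simp add: laplace_mult_right laplace_power[OF z] mult_ac)
qed

text \<open>The formal Borel transform with respect to the moments: by \<open>laplace_power\<close>
  the transform of \<open>u ^ k\<close> restores the factor \<open>moment k\<close>.\<close>

definition borel_coeff :: "complex fps \<Rightarrow> nat \<Rightarrow> complex" where
  "borel_coeff a k = fps_nth a k / of_real (moment k)"

text \<open>The first branch also covers negative \<open>u\<close>, where the series may diverge and
  \<open>suminf\<close> has no useful value; the kernel vanishes there, and
  \<open>laplace_cong\<close> compares functions for positive \<open>u\<close> only.\<close>

definition truncated_borel :: "real \<Rightarrow> complex fps \<Rightarrow> real \<Rightarrow> complex" where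
  "truncated_borel \<rho> a u = (if u < 1 / (2 * \<rho>) then \<Sum>k. borel_coeff a k * of_real u ^ k else 0)"

lemma truncated_borel_measurable: "truncated_borel \<rho> a \<in> borel_measurable borel"
  unfolding truncated_borel_def by measurable

text \<open>The moments grow at least like \<open>b ^ p * M p\<close> and the coefficients at most
  like \<open>A ^ p * M p\<close>, so their quotients grow at most like powers of
  \<open>\<rho> = A / b\<close>.\<close>

context
  fixes b c0 A \<rho> :: real
  assumes bc_pos: "0 < b" "0 < c0" and A_pos: "0 < A" and rho_def: "\<rho> = A / b"
    and moment_lower: "\<And>p. c0 * b ^ p * M p \<le> moment p"
begin

lemma rho_pos: "0 < \<rho>"
  using bc_pos A_pos by (simp add: rho_def)

lemma moment_pos: "0 < moment p"
proof -
  have "0 < c0 * b ^ p * M p" using bc_pos M_pos by simp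
  then show ?thesis using moment_lower[of p] by linarith
qed

lemma borel_coeff_bound:
  assumes a: "a \<in> fps_space M A"
  shows "norm (borel_coeff a k) \<le> fps_space_norm M A a / c0 * \<rho> ^ k"
proof -
  have pos: "0 < c0 * b ^ k * M k" using bc_pos M_pos by simp
  have "norm (borel_coeff a k) = norm (fps_nth a k) / moment k"
    using moment_pos[of k] by (simp add: borel_coeff_def norm_divide)
  also have "\<dots> \<le> (fps_space_norm M A a * A ^ k * M k) / (c0 * b ^ k * M k)"
    using fps_space_bound[of M, OF M_pos A_pos a, of k] moment_lower[of k] pos
    by (intro frac_le order_trans[OF norm_ge_zero]) auto
  also have "\<dots> = fps_space_norm M A a / c0 * \<rho> ^ k"
    using bc_pos M_pos[of k] by (simp add: rho_def power_divide)
  finally show ?thesis .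
qed

lemma truncated_borel_remainder:
  assumes a: "a \<in> fps_space M A" and u: "0 < u"
  shows "norm (truncated_borel \<rho> a u - (\<Sum>k<N. borel_coeff a k * of_real u ^ k))
    \<le> 2 * (fps_space_norm M A a / c0) * (2 * \<rho>) ^ N * u ^ N"
  unfolding truncated_borel_def
  by (rule truncated_power_series_remainder[OF borel_coeff_bound[OF a] rho_pos u])

lemma truncated_borel_bound:
  assumes a: "a \<in> fps_space M A" and u: "0 < u"
  shows "norm (truncated_borel \<rho> a u) \<le> 2 * (fps_space_norm M A a / c0) * u ^ 0"
  using truncated_borel_remainder[OF a u, of 0] by simp

lemma laplace_truncated_borel_holomorphic:
  assumes a: "a \<in> fps_space M A"
  shows "laplace (truncated_borel \<rho> a) rs_holomorphic_on sector \<gamma>"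
  by (rule laplace_holomorphic[OF truncated_borel_measurable truncated_borel_bound[OF a]])

lemma truncated_borel_integrable:
  assumes a: "a \<in> fps_space M A" and z: "z \<in> sector \<gamma>"
  shows "integrable lborel (\<lambda>u. kernel z u * truncated_borel \<rho> a u)"
  by (rule integrand_integrable[OF truncated_borel_measurable truncated_borel_bound[OF a] z])

text \<open>Since \<open>laplace_polynomial\<close> turns the partial sum in \<open>u\<close> into
  the partial sum of \<open>a\<close> in \<open>z\<close>, the left side is the transform of a
  function bounded by a multiple of \<open>u ^ N\<close>, and \<open>norm_laplace_le\<close>
  applies.\<close>

lemma laplace_truncated_borel_remainder:
  assumes a: "a \<in> fps_space M A" and z: "z \<in> sector \<gamma>"
  shows "norm (laplace (truncated_borel \<rho> a) z - (\<Sum>k<N. fps_nth a k * rs_proj z ^ k))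
    \<le> 2 * (fps_space_norm M A a / c0) * (2 * \<rho>) ^ N * kernel_const N * pi * rs_abs z ^ N"
proof -
  let ?\<psi> = "\<lambda>u. truncated_borel \<rho> a u - (\<Sum>k<N. borel_coeff a k * of_real u ^ k)"
  have "borel_coeff a k * of_real (moment k) = fps_nth a k" for k
    using moment_pos[of k] by (simp add: borel_coeff_def)
  then have "laplace ?\<psi> z = laplace (truncated_borel \<rho> a) z - (\<Sum>k<N. fps_nth a k * rs_proj z ^ k)"
    using laplace_diff[OF truncated_borel_integrable[OF a z] laplace_polynomial(1)[OF z]]
    by (simp add: laplace_polynomial(2)[OF z])
  moreover have "?\<psi> \<in> borel_measurable borel"
    using truncated_borel_measurable[measurable] by measurable
  then have "norm (laplace ?\<psi> z)
      \<le> 2 * (fps_space_norm M A a / c0) * (2 * \<rho>) ^ N * kernel_const N * pi * rs_abs z ^ N"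
    by (rule norm_laplace_le[OF _ truncated_borel_remainder[OF a] z])
  ultimately show ?thesis by simp
qed

lemma borel_series_summable:
  assumes a: "a \<in> fps_space M A" and u: "0 < u" "u < 1 / (2 * \<rho>)"
  shows "summable (\<lambda>k. borel_coeff a k * of_real u ^ k)"
proof (rule summable_comparison_test')
  have "\<rho> * u < 1" "0 < \<rho> * u" using u rho_pos by (auto simp: field_simps)
  then show "summable (\<lambda>k. fps_space_norm M A a / c0 * (\<rho> * u) ^ k)"
    by (intro summable_mult summable_geometric) simp
  show "norm (borel_coeff a k * of_real u ^ k) \<le> fps_space_norm M A a / c0 * (\<rho> * u) ^ k" for k
    using mult_right_mono[OF borel_coeff_bound[OF a, of k], of "u ^ k"] u
    by (simp add: norm_mult norm_power power_mult_distrib mult.assoc)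
qed

text \<open>All series in the space are cut at the same point, as \<open>\<rho>\<close> depends only
  on \<open>A\<close> and \<open>b\<close>. Below the cut they converge, so that
  \<open>suminf\<close> is linear there.\<close>

lemma laplace_truncated_borel_linear:
  "linear_map_on (fps_space M A) (sector \<gamma>) (\<lambda>a. laplace (truncated_borel \<rho> a))"
  unfolding linear_map_on_def
proof (intro conjI ballI allI)
  fix a a' z assume a: "a \<in> fps_space M A" and a': "a' \<in> fps_space M A" and z: "z \<in> sector \<gamma>"
  have "truncated_borel \<rho> (a + a') u = truncated_borel \<rho> a u + truncated_borel \<rho> a' u" if u: "0 < u" for u
    using suminf_add[OF borel_series_summable[OF a u] borel_series_summable[OF a' u]]
    by (simp add: truncated_borel_def borel_coeff_def add_divide_distrib distrib_right)
  then have "laplace (truncated_borel \<rho> (a + a')) z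
      = laplace (\<lambda>u. truncated_borel \<rho> a u + truncated_borel \<rho> a' u) z"
    by (rule laplace_cong)
  then show "laplace (truncated_borel \<rho> (a + a')) z
      = laplace (truncated_borel \<rho> a) z + laplace (truncated_borel \<rho> a') z"
    using laplace_add[OF truncated_borel_integrable[OF a z] truncated_borel_integrable[OF a' z]] by simp
next
  fix c a z assume a: "a \<in> fps_space M A" and z: "z \<in> sector \<gamma>"
  have "truncated_borel \<rho> (fps_const c * a) u = c * truncated_borel \<rho> a u" if u: "0 < u" for u
    using suminf_mult[OF borel_series_summable[OF a u], of c]
    by (simp add: truncated_borel_def borel_coeff_def mult.assoc)
  then have "laplace (truncated_borel \<rho> (fps_const c * a)) z = laplace (\<lambda>u. c * truncated_borel \<rho> a u) z"
    by (rule laplace_cong)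
  then show "laplace (truncated_borel \<rho> (fps_const c * a)) z = c * laplace (truncated_borel \<rho> a) z"
    by (simp add: laplace_mult_right)
qed

text \<open>The rate \<open>2 * \<rho>\<close> of the series and the rate \<open>B\<close> of the
  kernel multiply to \<open>2 * B / b * A\<close>, which is why the loss in the type is a factor
  independent of \<open>A\<close>.\<close>

lemma laplace_truncated_borel_quotients:
  assumes a: "a \<in> fps_space M A"
    and const: "\<And>N. kernel_const N \<le> C1 * B ^ N * M N" and B: "0 < B"
    and y: "y \<in> asymp_quotients M (2 * B / b * A) (sector \<gamma>) (laplace (truncated_borel \<rho> a)) a"
  shows "y \<le> 2 * C1 * pi / c0 * fps_space_norm M A a"
proof -
  obtain z N where z: "z \<in> sector \<gamma>"
    and y_eq: "y = norm (laplace (truncated_borel \<rho> a) z - (\<Sum>k<N. fps_nth a k * rs_proj z ^ k))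
      / ((2 * B / b * A) ^ N * M N * rs_abs z ^ N)"
    using y unfolding asymp_quotients_def by auto
  have pos: "0 < (2 * B / b * A) ^ N * M N * rs_abs z ^ N"
    using B bc_pos A_pos M_pos sector_abs_pos[OF z] by simp
  have "norm (laplace (truncated_borel \<rho> a) z - (\<Sum>k<N. fps_nth a k * rs_proj z ^ k))
      \<le> 2 * (fps_space_norm M A a / c0) * (2 * \<rho>) ^ N * kernel_const N * pi * rs_abs z ^ N"
    by (rule laplace_truncated_borel_remainder[OF a z])
  also have "\<dots> \<le> 2 * (fps_space_norm M A a / c0) * (2 * \<rho>) ^ N * (C1 * B ^ N * M N) * pi * rs_abs z ^ N"
    using bc_pos rho_pos sector_abs_pos[OF z] fps_space_norm_nonneg[of M, OF M_pos A_pos a]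
    by (intro mult_right_mono mult_left_mono const) auto
  also have "\<dots> = 2 * C1 * pi / c0 * fps_space_norm M A a * ((2 * \<rho>) ^ N * B ^ N * M N * rs_abs z ^ N)"
    by simp
  also have "(2 * \<rho>) ^ N * B ^ N = (2 * B / b * A) ^ N"
    by (simp add: rho_def mult_ac flip: power_mult_distrib)
  finally show ?thesis unfolding y_eq using pos by (simp only: pos_divide_le_eq)
qed

end

text \<open>Two applications of (dc) lead from \<open>N + 2\<close> to \<open>N\<close> at the cost
  of \<open>D ^ (2 * N + 3)\<close>, a constant times \<open>(D\<^sup>2) ^ N\<close>.\<close>

lemma kernel_const_le:
  assumes D: "1 \<le> D" "\<And>p. M (p + 1) \<le> D ^ (p + 1) * M p"
  shows "kernel_const N \<le> K3 * (1 + K4\<^sup>2 * D ^ 3) * (K4 * D\<^sup>2) ^ N * M N"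
proof -
  have "M (N + 2) \<le> D ^ (N + 2) * M (N + 1)" using D(2)[of "N + 1"] by simp
  also have "\<dots> \<le> D ^ (N + 2) * (D ^ (N + 1) * M N)" using D by (intro mult_left_mono) auto
  also have "\<dots> = D ^ 3 * (D\<^sup>2) ^ N * M N"
    by (simp add: power_add power_mult_distrib power2_eq_square power3_eq_cube)
  finally have "K4\<^sup>2 * M (N + 2) \<le> K4\<^sup>2 * (D ^ 3 * (D\<^sup>2) ^ N * M N)"
    by (intro mult_left_mono) auto
  moreover have "1 * M N \<le> (D\<^sup>2) ^ N * M N"
    using D M_pos[of N] by (intro mult_right_mono one_le_power) auto
  ultimately have "M N + K4\<^sup>2 * M (N + 2) \<le> (1 + K4\<^sup>2 * D ^ 3) * (D\<^sup>2) ^ N * M N"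
    by (simp add: algebra_simps)
  then have "kernel_const N \<le> K3 * K4 ^ N * ((1 + K4\<^sup>2 * D ^ 3) * (D\<^sup>2) ^ N * M N)"
    unfolding kernel_const_def using K_pos by (intro mult_left_mono) auto
  then show ?thesis by (simp add: power_mult_distrib mult_ac)
qed

text \<open>The factor is \<open>c = 2 * B / b\<close> with \<open>B\<close> from
  \<open>kernel_const_le\<close> and \<open>b\<close> from \<open>moment_ge\<close>. A single
  \<open>T\<close> for all \<open>p\<close> makes the constant \<open>c0\<close> in the lower bound
  of the moments independent of \<open>p\<close>.\<close>

lemma borel_map_right_inverse:
  assumes "dc M" and T: "0 < T"
    and attained: "\<And>p. \<exists>t>0. t \<le> T \<and> M p * t ^ p \<le> h_fun M t"
  shows "\<exists>c>0. \<forall>A>0. \<exists>E. linear_continuous_map M A (c * A) (sector \<gamma>) E \<and>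
    (\<forall>a\<in>fps_space M A. borel_map M (c * A) (sector \<gamma>) (E a) = a)"
proof -
  obtain D0 where D0: "0 < D0" "\<And>p. M (p + 1) \<le> D0 ^ (p + 1) * M p"
    using \<open>dc M\<close> unfolding dc_def by auto
  define D where "D = max 1 D0"
  have D: "1 \<le> D" by (simp add: D_def)
  have dc: "M (p + 1) \<le> D ^ (p + 1) * M p" for p
  proof -
    have "D0 ^ (p + 1) * M p \<le> D ^ (p + 1) * M p"
      using D0 M_pos[of p] by (intro mult_right_mono power_mono) (auto simp: D_def)
    then show ?thesis using D0(2)[of p] by linarith
  qed
  define B where "B = K4 * D\<^sup>2"
  have B: "0 < B" using K_pos D by (simp add: B_def)
  have const: "kernel_const N \<le> K3 * (1 + K4\<^sup>2 * D ^ 3) * B ^ N * M N" for N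
    unfolding B_def by (rule kernel_const_le[OF D dc])
  define b where "b = K2 / 2"
  define c0 where "c0 = K1 * K2 / T"
  have bc: "0 < b" "0 < c0" using K_pos T by (simp_all add: b_def c0_def)
  have moment: "c0 * b ^ p * M p \<le> moment p" for p
  proof -
    obtain t where "0 < t" "t \<le> T" "M p * t ^ p \<le> h_fun M t"
      using attained[of p] by auto
    then show ?thesis unfolding b_def c0_def by (rule moment_ge)
  qed
  have "\<exists>E. linear_continuous_map M A (2 * B / b * A) (sector \<gamma>) E \<and>
      (\<forall>a\<in>fps_space M A. borel_map M (2 * B / b * A) (sector \<gamma>) (E a) = a)" if A: "0 < A" for A
  proof (intro exI bounded_right_inverse_of_borel_map[of M, OF M_pos A _ gamma_pos])
    show "0 < 2 * B / b * A" using B bc A by simp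
    show "linear_map_on (fps_space M A) (sector \<gamma>) (\<lambda>a. laplace (truncated_borel (A / b) a))"
      by (rule laplace_truncated_borel_linear[OF bc A refl moment])
    show "laplace (truncated_borel (A / b) a) rs_holomorphic_on sector \<gamma>"
      if "a \<in> fps_space M A" for a
      by (rule laplace_truncated_borel_holomorphic[OF bc A refl moment that])
    show "y \<le> 2 * (K3 * (1 + K4\<^sup>2 * D ^ 3)) * pi / c0 * fps_space_norm M A a"
      if "a \<in> fps_space M A"
        and "y \<in> asymp_quotients M (2 * B / b * A) (sector \<gamma>) (laplace (truncated_borel (A / b) a)) a"
      for a y
      by (rule laplace_truncated_borel_quotients[OF bc A refl moment that(1) const B that(2)])
  qed
  then show ?thesis using B bc by (intro exI[of _ "2 * B / b"]) simp
qed

end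

theorem mainTheorem8:
  fixes M1 M2 :: "nat \<Rightarrow> real" and \<gamma> :: real and S :: "log_point set"
    and G1 G2 :: "log_point \<Rightarrow> complex"
  assumes "weight_sequence M1" and "weight_sequence M2"
    and "\<gamma> > 0" and "S = sector \<gamma>"
    and "optimal_flat M1 S G1" and "optimal_flat M2 S G2"
  shows "optimal_flat (M1 \<star> M2) S (\<lambda>z. G1 z * G2 z) \<and>
    (dc M1 \<or> dc M2 \<longrightarrow>
      dc (M1 \<star> M2) \<and>
      (\<exists>c>0. \<forall>A>0. \<exists>T. linear_continuous_map (M1 \<star> M2) A (c * A) S T \<and>
         (\<forall>a\<in>fps_space (M1 \<star> M2) A. borel_map (M1 \<star> M2) (c * A) S (T a) = a)))"
proof (intro conjI impI)
  have pos1: "0 < M1 p" and pos2: "0 < M2 p" for p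
    using assms(1,2) by (auto simp: weight_sequence_def)
  have "S \<subseteq> log_surface" using assms(4) by (auto simp: sector_def)
  then show flat: "optimal_flat (M1 \<star> M2) S (\<lambda>z. G1 z * G2 z)"
    by (rule optimal_flat_mult[of M1 M2, OF pos1 pos2 _ assms(5,6)])
  assume dc: "dc M1 \<or> dc M2"
  then show dcL: "dc (M1 \<star> M2)"
    by (rule dc_conv_seq[of M1 M2, OF pos1 pos2])
  obtain K1 K2 K3 K4 where "flat_kernel (M1 \<star> M2) \<gamma> (\<lambda>z. G1 z * G2 z) K1 K2 K3 K4"
  proof (rule optimal_flatE[OF flat], goal_cases)
    case (1 K1 K2 K3 K4)
    have "flat_kernel (M1 \<star> M2) \<gamma> (\<lambda>z. G1 z * G2 z) K1 K2 K3 K4"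
      using 1(2-) assms(3) conv_seq_pos[of M1 M2, OF pos1 pos2]
      unfolding assms(4) by unfold_locales
    then show ?case by (rule 1(1))
  qed
  then interpret flat_kernel "M1 \<star> M2" \<gamma> "\<lambda>z. G1 z * G2 z" K1 K2 K3 K4 .
  \<comment> \<open>The bound on the points of attainment is read off from the first quotients of
    the two factors.\<close>
  have "0 < 1 / min (M1 1) (M2 1)" using pos1[of 1] pos2[of 1] by simp
  moreover have "\<exists>t>0. t \<le> 1 / min (M1 1) (M2 1) \<and> (M1 \<star> M2) p * t ^ p \<le> h_fun (M1 \<star> M2) t" for p
    by (rule conv_seq_h_fun_attained[OF assms(1,2), of p]) (intro exI conjI, auto)
  ultimately show "\<exists>c>0. \<forall>A>0. \<exists>T. linear_continuous_map (M1 \<star> M2) A (c * A) S T \<and>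
      (\<forall>a\<in>fps_space (M1 \<star> M2) A. borel_map (M1 \<star> M2) (c * A) S (T a) = a)"
    unfolding assms(4) by (rule borel_map_right_inverse[OF dcL])
qed

end
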